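(* Let $\Omega$ be a Lebesgue measurable subset of $\mathbb{R}^N$ of finite Lebesgue measure and let $\overline{\dim}_B(\infty,\Omega)=\overline D$ with $\overline D\in\mathbb{R}$, $\overline D<-N$. Assume that the tube zeta function $\widetilde\zeta_{\infty,\Omega}$ can be meromorphically extended to a neighborhood $U$ of the critical line $\{\operatorname{Re}s=\overline D\}$, that $\overline D$ is its only pole in $U$, and that this pole is simple. Then $D:=\dim_B(\infty,\Omega)$ exists, $D=\overline D$, and $(\infty,\Omega)$ is Minkowski measurable with $$\mathcal M^D(\infty,\Omega)=\operatorname{res}(\widetilde\zeta_{\infty,\Omega},D).$$ Moreover, the statement remains valid if the tube zeta function is replaced by the distance zeta function $\zeta_{\infty,\Omega}$ in the hypotheses, and in that case $$\mathcal M^D(\infty,\Omega)=\frac{\operatorname{res}(\zeta_{\infty,\Omega},D)}{-(N+D)}.$$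
   Context: $|\cdot|$ denotes the Euclidean norm of a vector in $\mathbb{R}^N$ and the $N$-dimensional Lebesgue measure of a set. For $t>0$, ${}_t\Omega:=B_t(0)^c\cap\Omega$, where $B_t(0)$ is the open Euclidean ball of radius $t$ centered at $0$. For $r\in\mathbb{R}$, the upper and lower $r$-dimensional Minkowski contents of $\Omega$ at infinity, $\overline{\mathcal M}^r(\infty,\Omega)$ and $\underline{\mathcal M}^r(\infty,\Omega)$, are the $\limsup$ and $\liminf$ of $|{}_t\Omega|/t^{N+r}$ as $t\to+\infty$; if they coincide the common value is $\mathcal M^r(\infty,\Omega)$. The upper (lower) Minkowski dimension $\overline{\dim}_B(\infty,\Omega)$ ($\underline{\dim}_B(\infty,\Omega)$) is the infimum of all $r\in\mathbb{R}$ for which the upper (lower) $r$-dimensional content is $0$; if both coincide the common value is $\dim_B(\infty,\Omega)$. $(\infty,\Omega)$ is Minkowski measurable if for $D=\dim_B(\infty,\Omega)$ one has $0<\underline{\mathcal M}^D(\infty,\Omega)=\overline{\mathcal M}^D(\infty,\Omega)<\infty$. For a fixed $T>0$, the tube zeta function at infinity is $\widetilde\zeta_{\infty,\Omega}(s):=\int_T^{+\infty}t^{-s-N-1}|{}_t\Omega|\,dt$ and the distance zeta function at infinity is $\zeta_{\infty,\Omega}(s):=\int_{{}_T\Omega}|x|^{-s-N}\,dx$; both are holomorphic on $\{\operatorname{Re}s>\overline{\dim}_B(\infty,\Omega)\}$ and changing $T$ only adds an entire function. Meromorphic extension to $U$ (an open set containing the line) means extension from this half-plane. $\operatorname{res}(f,\omega)$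 is the residue of $f$ at $\omega$. *)

theory Defs
  imports "HOL-Complex_Analysis.Complex_Analysis"
begin

definition tail_infty :: "real \<Rightarrow> (real ^ 'n) set \<Rightarrow> (real ^ 'n) set" where
  "tail_infty t \<Omega> = - ball 0 t \<inter> \<Omega>"

definition upper_minkowski_content_infty :: "real \<Rightarrow> (real ^ 'n) set \<Rightarrow> ennreal" where
  "upper_minkowski_content_infty r \<Omega> =
     Limsup at_top (\<lambda>t::real. emeasure lebesgue (tail_infty t \<Omega>) / ennreal (t powr (real CARD('n) + r)))"

definition lower_minkowski_content_infty :: "real \<Rightarrow> (real ^ 'n) set \<Rightarrow> ennreal" where
  "lower_minkowski_content_infty r \<Omega> =
     Liminf at_top (\<lambda>t::real. emeasure lebesgue (tail_infty t \<Omega>) / ennreal (t powr (real CARD('n) + r)))"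

text \<open>Only meaningful when the upper and lower contents coincide.\<close>

definition minkowski_content_infty :: "real \<Rightarrow> (real ^ 'n) set \<Rightarrow> ennreal" where
  "minkowski_content_infty r \<Omega> =
     (THE m. lower_minkowski_content_infty r \<Omega> = m \<and> upper_minkowski_content_infty r \<Omega> = m)"

text \<open>The infima range over real exponents but are taken in the extended reals, so that they may
  be infinite.\<close>

definition upper_minkowski_dim_infty :: "(real ^ 'n) set \<Rightarrow> ereal" where
  "upper_minkowski_dim_infty \<Omega> = (INF r \<in> {r. upper_minkowski_content_infty r \<Omega> = 0}. ereal r)"

definition lower_minkowski_dim_infty :: "(real ^ 'n) set \<Rightarrow> ereal" where
  "lower_minkowski_dim_infty \<Omega> = (INF r \<in> {r. lower_minkowski_content_infty r \<Omega> = 0}. ereal r)"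

text \<open>The Minkowski dimension at infinity exists and equals \<open>d\<close>.\<close>

definition has_minkowski_dim_infty :: "(real ^ 'n) set \<Rightarrow> ereal \<Rightarrow> bool" where
  "has_minkowski_dim_infty \<Omega> d \<longleftrightarrow>
     lower_minkowski_dim_infty \<Omega> = d \<and> upper_minkowski_dim_infty \<Omega> = d"

definition minkowski_measurable_infty :: "(real ^ 'n) set \<Rightarrow> bool" where
  "minkowski_measurable_infty \<Omega> \<longleftrightarrow>
     (\<exists>D::real. has_minkowski_dim_infty \<Omega> (ereal D) \<and>
        0 < lower_minkowski_content_infty D \<Omega> \<and>
        lower_minkowski_content_infty D \<Omega> = upper_minkowski_content_infty D \<Omega> \<and>
        upper_minkowski_content_infty D \<Omega> < \<infinity>)"

definition tube_zeta_infty :: "real \<Rightarrow> (real ^ 'n) set \<Rightarrow> complex \<Rightarrow> complex" where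
  "tube_zeta_infty T \<Omega> s =
     (LINT t:{T..}|lborel. complex_of_real t powr (- s - of_nat CARD('n) - 1) *
        complex_of_real (measure lebesgue (tail_infty t \<Omega>)))"

definition distance_zeta_infty :: "real \<Rightarrow> (real ^ 'n) set \<Rightarrow> complex \<Rightarrow> complex" where
  "distance_zeta_infty T \<Omega> s =
     (LINT x:tail_infty T \<Omega>|lebesgue. complex_of_real (norm x) powr (- s - of_nat CARD('n)))"

text \<open>\<open>g\<close> is a meromorphic extension of \<open>f\<close> from the half-plane to the right of the line
  \<open>Re s = a\<close> to the open neighbourhood \<open>U\<close> of that line. As usual for \<open>meromorphic_on\<close>, the values
  of \<open>g\<close> at its poles carry no information.\<close>

definition meromorphic_extension ::
    "(complex \<Rightarrow> complex) \<Rightarrow> real \<Rightarrow> complex set \<Rightarrow> (complex \<Rightarrow> complex) \<Rightarrow> bool" where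
  "meromorphic_extension f a U g \<longleftrightarrow>
     open U \<and> {s. Re s = a} \<subseteq> U \<and>
     g meromorphic_on ({s. Re s > a} \<union> U) \<and> (\<forall>s. Re s > a \<longrightarrow> g s = f s)"

text \<open>\<open>zorder\<close> is negative at poles, with the pole order as absolute value.\<close>

definition only_pole_simple :: "(complex \<Rightarrow> complex) \<Rightarrow> complex set \<Rightarrow> complex \<Rightarrow> bool" where
  "only_pole_simple g U z \<longleftrightarrow> {w \<in> U. is_pole g w} = {z} \<and> zorder g z = - 1"

end

theory Submission
  imports Defs
begin

text \<open>
  Let \<open>N\<close> be the dimension of the space and \<open>V t\<close> the volume of the part of \<open>\<Omega>\<close> outside the ball of radius
  \<open>t\<close>. Put \<open>B x = exp (- (N + D) * x) * V (exp x)\<close>, so that the \<open>D\<close>-dimensional content at infinity is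
  the limit of \<open>B\<close>, if it exists. After the substitution \<open>t = exp x\<close> the tube zeta function at \<open>D + w\<close> is
  the Laplace transform of \<open>B\<close> at \<open>w\<close>. The hypothesis says that this transform, up to a simple pole
  \<open>A / w\<close>, extends continuously to the line \<open>Re w = 0\<close>, and \<open>V\<close> being decreasing says that \<open>B\<close> cannot grow
  faster than \<open>exp (\<delta> * x)\<close> with \<open>\<delta> = - (N + D) > 0\<close>. This is the situation of the Wiener-Ikehara Tauberian
  theorem, whose conclusion is that \<open>B\<close> tends to \<open>A\<close>, the residue (lemma \<open>wiener_ikehara\<close>).

  The Tauberian theorem is proved by Wiener's method. The transform is tested, on a line slightly to
  the right of the boundary, against a triangular function of compact support, which yields averages
  of \<open>B\<close> with respect to a Fejer kernel (\<open>fejer_fubini\<close>); the line is moved to the boundary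
  (\<open>fejer_mean_boundary\<close>), and the Riemann-Lebesgue lemma shows that the averages converge
  (\<open>fejer_mean_limit\<close>). The growth condition turns the convergence of the averages at all scales into
  convergence of \<open>B\<close>. The compact support is essential, as nothing is known about the size of the
  extension along the critical line.

  A positive limit \<open>A\<close> determines the lower dimension and both contents (\<open>minkowski_measurable_from_limit\<close>).
  For the distance zeta function, integrating by parts in the radius gives
  \<open>\<zeta> s = T powr (- s - N) * V T - (s + N) * tube s\<close> (\<open>distance_zeta_eq_tube_zeta\<close>). Near the line \<open>Re s = D < - N\<close>
  the factor \<open>- (s + N)\<close> has no zero, so the two functions have the same singularities there, and the
  residues at \<open>D\<close> differ by the factor \<open>- (N + D)\<close>.
\<close>

section \<open>The Fejer kernel\<close>

definition tent :: "real \<Rightarrow> real" where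
  "tent z = max 0 (1 - \<bar>z\<bar>)"

text \<open>
  The Fourier transform of \<^const>\<open>tent\<close>. The value \<open>1\<close> at the origin is the continuous extension.
\<close>

definition fejer :: "real \<Rightarrow> real" where
  "fejer x = (if x = 0 then 1 else 2 * (1 - cos x) / x\<^sup>2)"

lemma tent_nonneg: "tent z \<ge> 0"
  by (simp add: tent_def)

lemma continuous_on_tent [continuous_intros]:
  "continuous_on A f \<Longrightarrow> continuous_on A (\<lambda>x. tent (f x))"
  unfolding tent_def by (intro continuous_intros)

lemma borel_measurable_tent [measurable]: "tent \<in> borel_measurable borel"
  by (intro borel_measurable_continuous_onI continuous_intros)

lemma borel_measurable_cis [measurable]: "cis \<in> borel_measurable borel"
  by (intro borel_measurable_continuous_onI continuous_on_cis continuous_on_id)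

lemma tent_eq_0: "\<bar>z\<bar> \<ge> 1 \<Longrightarrow> tent z = 0"
  by (simp add: tent_def)

lemma integrable_tent: "integrable lborel tent"
proof (rule Bochner_Integration.integrable_bound[of _ "indicator {-1..1} :: real \<Rightarrow> real"])
  show "AE z in lborel. norm (tent z) \<le> norm (indicator {-1..1} z :: real)"
    by (auto simp: tent_def indicator_def)
qed auto

lemma fejer_nonneg: "fejer x \<ge> 0"
  by (simp add: fejer_def)

lemma one_minus_cos_le: "2 * (1 - cos x) \<le> (x::real)\<^sup>2"
proof -
  have "2 * (1 - cos x) = 4 * (sin (x/2))\<^sup>2"
    using cos_double_sin[of "x/2"] by simp
  also have "\<dots> \<le> 4 * (x/2)\<^sup>2"
    using abs_sin_x_le_abs_x[of "x/2"] by (simp only: abs_le_square_iff mult_le_cancel_left_pos zero_less_numeral)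
  finally show ?thesis by (simp add: power2_eq_square)
qed

lemma fejer_le_1: "fejer x \<le> 1"
  using one_minus_cos_le[of x] by (auto simp: fejer_def divide_simps)

text \<open>
  The bound is chosen so that a single integrable majorant covers both regimes: near the origin
  the kernel is at most \<open>1\<close>, and far away it is at most \<open>4 / x\<^sup>2\<close>; the two estimates meet at \<open>\<bar>x\<bar> = 2\<close>.
\<close>

lemma fejer_le: "fejer x \<le> 5 * inverse (1 + x\<^sup>2)"
proof (cases "x\<^sup>2 \<le> 4")
  case True
  have "1 \<le> 5 * inverse (1 + x\<^sup>2)"
    using True by (simp add: field_simps add_pos_nonneg)
  thus ?thesis using fejer_le_1[of x] by linarith
next
  case False
  hence [simp]: "x \<noteq> 0" by auto
  have pos: "1 + x\<^sup>2 > 0" by (simp add: add_pos_nonneg)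
  have "2 * (1 - cos x) \<le> 4"
    using cos_ge_minus_one[of x] by argo
  hence "fejer x \<le> 4 / x\<^sup>2"
    by (simp add: fejer_def divide_right_mono)
  also have "\<dots> \<le> 5 / (1 + x\<^sup>2)"
    using False pos by (simp add: frac_le_eq divide_simps)
  finally show ?thesis by (simp add: divide_simps)
qed

lemma borel_measurable_fejer [measurable]: "fejer \<in> borel_measurable borel"
  unfolding fejer_def by measurable

lemma integrable_fejer: "integrable lborel fejer"
proof -
  have "set_integrable lborel (einterval (-\<infinity>) \<infinity>) (\<lambda>x. inverse (1 + x^2))"
  proof (rule interval_integral_FTC_nonneg[where F = arctan])
    show "isCont (\<lambda>x. inverse (1 + x\<^sup>2)) x" for x :: real
      by (intro continuous_intros) (metis add_pos_nonneg less_irrefl zero_le_power2 zero_less_one)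
    show "DERIV arctan x :> inverse (1 + x\<^sup>2)" for x
      by (rule DERIV_arctan)
    show "((arctan \<circ> real_of_ereal) \<longlongrightarrow> - pi / 2) (at_right (- \<infinity>))"
      by (simp add: ereal_tendsto_simps tendsto_arctan_at_bot flip: comp_def)
    show "((arctan \<circ> real_of_ereal) \<longlongrightarrow> pi / 2) (at_left \<infinity>)"
      by (simp add: ereal_tendsto_simps tendsto_arctan_at_top flip: comp_def)
  qed (auto simp: add_nonneg_nonneg)
  hence "integrable lborel (\<lambda>x::real. 5 * inverse (1 + x\<^sup>2))"
    by (simp add: set_integrable_def)
  thus ?thesis
  proof (rule Bochner_Integration.integrable_bound)
    show "AE x in lborel. norm (fejer x) \<le> norm (5 * inverse (1 + x\<^sup>2))"
      using fejer_nonneg fejer_le by (intro AE_I2) (auto intro: order_trans)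
  qed auto
qed

text \<open>
  The integrand has an elementary antiderivative on each of the two pieces on which the tent is
  affine; at \<open>x = 0\<close> the antiderivative degenerates and the area of the triangle is computed directly.
\<close>

lemma fourier_tent:
  "(\<integral>z. tent z *\<^sub>R cis (z * x) \<partial>lborel) = complex_of_real (fejer x)"
proof -
  let ?f = "\<lambda>z. tent z *\<^sub>R cis (z * x)"
  have halves: "\<exists>I J. (?f has_integral I) {-1..0} \<and> (?f has_integral J) {0..1} \<and> I + J = of_real (fejer x)"
  proof (cases "x = 0")
    case True
    let ?F = "\<lambda>s w :: complex. w + s * w\<^sup>2 / 2"
    have "(?f has_integral ?F 1 (of_real 0) - ?F 1 (of_real (-1))) {-1..0}"
      by (rule fundamental_theorem_of_calculus, simp, rule has_vector_derivative_real_field)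
         (auto simp: True tent_def scaleR_conv_of_real intro!: derivative_eq_intros)
    moreover have "(?f has_integral ?F (-1) (of_real 1) - ?F (-1) (of_real 0)) {0..1}"
      by (rule fundamental_theorem_of_calculus, simp, rule has_vector_derivative_real_field)
         (auto simp: True tent_def scaleR_conv_of_real intro!: derivative_eq_intros)
    ultimately show ?thesis
      by (intro exI conjI) (assumption, assumption, simp add: True fejer_def)
  next
    case False
    let ?F = "\<lambda>s w. (1 + s * w) * exp (\<i> * w * x) / (\<i> * x) - s * exp (\<i> * w * x) / (\<i> * x)^2"
    have D: "(?F s has_field_derivative ((1 + s * w) * exp (\<i> * w * x))) (at w within A)" for s w A
      using False by (auto intro!: derivative_eq_intros simp: divide_simps power2_eq_square)
    have "(?f has_integral ?F 1 (of_real 0) - ?F 1 (of_real (-1))) {-1..0}"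
    proof (rule fundamental_theorem_of_calculus)
      fix z :: real assume z: "z \<in> {-1..0}"
      have eq: "tent z *\<^sub>R cis (z * x) = (1 + 1 * of_real z) * exp (\<i> * of_real z * x)"
        using z by (simp add: tent_def cis_conv_exp scaleR_conv_of_real mult_ac)
      show "((\<lambda>z. ?F 1 (of_real z)) has_vector_derivative ?f z) (at z within {-1..0})"
        unfolding eq by (rule has_vector_derivative_real_field[OF D])
    qed auto
    moreover have "(?f has_integral ?F (-1) (of_real 1) - ?F (-1) (of_real 0)) {0..1}"
    proof (rule fundamental_theorem_of_calculus)
      fix z :: real assume z: "z \<in> {0..1}"
      have eq: "tent z *\<^sub>R cis (z * x) = (1 + (-1) * of_real z) * exp (\<i> * of_real z * x)"
        using z by (simp add: tent_def cis_conv_exp scaleR_conv_of_real mult_ac)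
      show "((\<lambda>z. ?F (-1) (of_real z)) has_vector_derivative ?f z) (at z within {0..1})"
        unfolding eq by (rule has_vector_derivative_real_field[OF D])
    qed auto
    moreover have "exp (\<i> * x) + exp (-(\<i> * x)) = of_real (2 * cos x)"
      by (simp add: complex_eq_iff Re_exp Im_exp)
    hence exp_minus: "exp (-(\<i> * x)) = of_real (2 * cos x) - exp (\<i> * x)"
      by (simp add: algebra_simps)
    have "?F 1 (of_real 0) - ?F 1 (of_real (-1)) + (?F (-1) (of_real 1) - ?F (-1) (of_real 0)) = of_real (fejer x)"
      using False by (simp add: fejer_def exp_minus field_simps power2_eq_square)
    ultimately show ?thesis by blast
  qed
  then obtain I J where IJ: "(?f has_integral I) {-1..0}" "(?f has_integral J) {0..1}" "I + J = of_real (fejer x)"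
    by blast
  have "(?f has_integral (I + J)) {-1..1}"
    by (rule has_integral_combine[OF _ _ IJ(1,2)]) auto
  hence "(?f has_integral (I + J)) UNIV"
    by (rule has_integral_on_superset) (auto simp: tent_def)
  moreover have "integrable lborel ?f"
    by (rule Bochner_Integration.integrable_bound[OF integrable_tent]) (auto simp: tent_nonneg)
  hence "(?f has_integral (\<integral>z. ?f z \<partial>lborel)) UNIV"
    by (rule has_integral_integral_lborel)
  ultimately have "(\<integral>z. ?f z \<partial>lborel) = I + J"
    using has_integral_unique by blast
  thus ?thesis using IJ(3) by simp
qed

section \<open>Fourier integrals\<close>

text \<open>
  Shifting the variable by half a period \<open>pi / u\<close> changes the sign of the oscillating factor, so
  twice the integral is the integral of \<open>\<phi> y - \<phi> (y + pi / u)\<close> against a factor of modulus one. This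
  difference tends to \<open>0\<close> pointwise because \<open>\<phi>\<close> is continuous, and it is dominated since both terms
  live on one bounded interval.
\<close>

lemma riemann_lebesgue_compact_support:
  fixes \<phi> :: "real \<Rightarrow> complex"
  assumes cont: "continuous_on UNIV \<phi>" and supp: "\<And>y. \<bar>y\<bar> > R \<Longrightarrow> \<phi> y = 0"
  shows "((\<lambda>u. \<integral>y. \<phi> y * cis (u * y) \<partial>lborel) \<longlongrightarrow> 0) at_top"
proof -
  have [measurable]: "\<phi> \<in> borel_measurable borel"
    using cont by (rule borel_measurable_continuous_onI)
  have "compact (\<phi> ` {-R..R})"
    using cont by (intro compact_continuous_image) (auto intro: continuous_on_subset)
  then obtain M0 where M0: "\<And>y. y \<in> {-R..R} \<Longrightarrow> norm (\<phi> y) \<le> M0"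
    by (metis compact_imp_bounded bounded_iff imageI)
  define M where "M = max M0 0"
  have M: "norm (\<phi> y) \<le> M * indicator {-R..R} y" for y
    using M0[of y] supp[of y] by (cases "y \<in> {-R..R}") (auto simp: M_def)
  have int: "integrable lborel \<phi>"
    by (rule Bochner_Integration.integrable_bound[of _ "\<lambda>y. M * indicator {-R..R} y"])
       (use M in \<open>auto simp: M_def emeasure_lborel_Icc_eq
          intro!: integrable_mult_right integrable_real_indicator\<close>)
  define I where "I = (\<lambda>u. \<integral>y. \<phi> y * cis (u * y) \<partial>lborel)"
  define E where "E = (\<lambda>u. \<integral>y. norm (\<phi> y - \<phi> (y + pi / u)) \<partial>lborel)"
  have int_cis: "integrable lborel (\<lambda>y. \<phi> (c + y) * cis (u * y))" for u c
    by (rule Bochner_Integration.integrable_bound[OF lborel_integrable_real_affine[OF int, of 1 c]])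
       (auto simp: norm_mult)
  have bound: "norm (I u) \<le> E u / 2" if "u > 0" for u
  proof -
    have "I u = (\<integral>y. \<phi> (pi / u + y) * cis (u * (pi / u + y)) \<partial>lborel)"
      unfolding I_def by (subst lborel_integral_real_affine[where c=1 and t="pi/u"]) auto
    also have "\<dots> = - (\<integral>y. \<phi> (pi / u + y) * cis (u * y) \<partial>lborel)"
      using that by (subst integral_minus [symmetric], intro Bochner_Integration.integral_cong)
                    (auto simp: distrib_left cis_mult[symmetric])
    finally have "2 * I u = I u - (\<integral>y. \<phi> (pi / u + y) * cis (u * y) \<partial>lborel)"
      by simp
    also have "\<dots> = (\<integral>y. \<phi> y * cis (u * y) - \<phi> (pi / u + y) * cis (u * y) \<partial>lborel)"
      unfolding I_def using int_cis[of 0 u] int_cis[of "pi / u" u] by simp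
    also have "norm \<dots> \<le> (\<integral>y. norm (\<phi> y * cis (u * y) - \<phi> (pi / u + y) * cis (u * y)) \<partial>lborel)"
      by (rule integral_norm_bound)
    also have "\<dots> = E u"
      unfolding E_def by (intro Bochner_Integration.integral_cong)
        (auto simp: norm_mult add.commute simp flip: left_diff_distrib)
    finally show ?thesis by (simp add: norm_mult)
  qed
  have "(E \<longlongrightarrow> (\<integral>y. norm (\<phi> y - \<phi> (y + 0)) \<partial>lborel)) at_top"
    unfolding E_def
  proof (rule integral_dominated_convergence_at_top)
    show "integrable lborel (\<lambda>y. 2 * M * indicator {-R-pi..R+pi} y :: real)"
      by (intro integrable_mult_right integrable_real_indicator) (auto simp: emeasure_lborel_Icc_eq)
    have "((\<lambda>u. norm (\<phi> y - \<phi> (y + pi / u))) \<longlongrightarrow> norm (\<phi> y - \<phi> (y + 0))) at_top" for y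
    proof -
      have "((\<lambda>u. y + pi / u) \<longlongrightarrow> y + 0) at_top"
        by (intro tendsto_intros tendsto_divide_0[OF tendsto_const] filterlim_ident
              filterlim_mono[OF filterlim_ident at_top_le_at_infinity order_refl])
      hence "((\<lambda>u. \<phi> (y + pi / u)) \<longlongrightarrow> \<phi> (y + 0)) at_top"
        by (rule continuous_on_tendsto_compose[OF cont]) auto
      thus ?thesis by (intro tendsto_intros)
    qed
    thus "AE y in lborel. ((\<lambda>u. norm (\<phi> y - \<phi> (y + pi / u))) \<longlongrightarrow> norm (\<phi> y - \<phi> (y + 0))) at_top"
      by simp
    show "\<forall>\<^sub>F u in at_top. AE y in lborel. norm (norm (\<phi> y - \<phi> (y + pi / u))) \<le> 2 * M * indicator {-R-pi..R+pi} y"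
      using eventually_ge_at_top[of 1]
    proof eventually_elim
      case (elim u)
      have pu: "0 \<le> pi / u" "pi / u \<le> pi"
        using elim by (auto simp: field_simps)
      have "norm (\<phi> y - \<phi> (y + pi / u)) \<le> 2 * M * indicator {-R-pi..R+pi} y" for y
      proof -
        have "norm (\<phi> y - \<phi> (y + pi / u)) \<le> norm (\<phi> y) + norm (\<phi> (y + pi / u))"
          by (rule norm_triangle_ineq4)
        also have "\<dots> \<le> M * indicator {-R..R} y + M * indicator {-R..R} (y + pi / u)"
          by (intro add_mono M)
        also have "\<dots> \<le> M * indicator {-R-pi..R+pi} y + M * indicator {-R-pi..R+pi} y"
          using pu pi_gt_zero by (intro add_mono mult_left_mono) (auto simp: M_def indicator_def)
        finally show ?thesis by simp
      qed
      thus ?case by simp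
    qed
  qed auto
  hence "((\<lambda>u. E u / 2) \<longlongrightarrow> 0 / 2) at_top"
    by (intro tendsto_intros) simp_all
  hence E_lim: "((\<lambda>u. E u / 2) \<longlongrightarrow> 0) at_top"
    by simp
  have "(I \<longlongrightarrow> 0) at_top"
    by (rule Lim_null_comparison[OF _ E_lim])
       (use bound in \<open>auto intro: eventually_mono[OF eventually_gt_at_top[of 0]]\<close>)
  thus ?thesis unfolding I_def .
qed

text \<open>
  Testing the Fourier transform \<open>L\<close> of \<open>b\<close> against a tent of half-width \<open>a\<close> sees only the frequencies
  \<open>\<bar>y\<bar> \<le> a\<close>, and produces the average of \<open>b\<close> around \<open>u\<close> with weight the Fejer kernel at scale \<open>1 / a\<close>.
  The tent makes the double integral absolutely convergent.
\<close>

lemma fejer_fubini: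
  fixes b :: "real \<Rightarrow> real"
  assumes int: "integrable lborel b"
  defines "L \<equiv> (\<lambda>y. \<integral>x. b x *\<^sub>R cis (-(y * x)) \<partial>lborel)"
  shows "integrable lborel (\<lambda>z. tent z *\<^sub>R (cis (a * u * z) * L (a * z)))" (is ?A)
    and "(\<integral>z. tent z *\<^sub>R (cis (a * u * z) * L (a * z)) \<partial>lborel) =
           complex_of_real (\<integral>x. b x * fejer (a * (u - x)) \<partial>lborel)" (is ?B)
proof -
  define f where "f = (\<lambda>z x. (tent z * b x) *\<^sub>R cis (z * (a * (u - x))))"
  have [measurable]: "b \<in> borel_measurable borel"
    using int by simp
  have f_integrable: "integrable (lborel \<Otimes>\<^sub>M lborel) (case_prod f)"
  proof (rule lborel_pair.Fubini_integrable)
    show "case_prod f \<in> borel_measurable (lborel \<Otimes>\<^sub>M lborel)"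
      unfolding f_def by measurable
    have "(\<lambda>z. \<integral>x. norm (case_prod f (z, x)) \<partial>lborel) = (\<lambda>z. tent z * (\<integral>x. \<bar>b x\<bar> \<partial>lborel))"
      by (auto simp: f_def abs_mult tent_nonneg)
    thus "integrable lborel (\<lambda>z. \<integral>x. norm (case_prod f (z, x)) \<partial>lborel)"
      using integrable_tent by simp
    have "integrable lborel (\<lambda>x. f z x)" for z
      by (rule Bochner_Integration.integrable_bound[OF integrable_mult_right[OF int, of "tent z"]])
         (auto simp: f_def)
    thus "AE z in lborel. integrable lborel (\<lambda>x. case_prod f (z, x))"
      by simp
  qed
  have inner: "(\<integral>x. f z x \<partial>lborel) = tent z *\<^sub>R (cis (a * u * z) * L (a * z))" for z
  proof -
    have "(\<integral>x. f z x \<partial>lborel) = (\<integral>x. (tent z *\<^sub>R cis (a * u * z)) * (b x *\<^sub>R cis (-(a * z * x))) \<partial>lborel)"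
      unfolding f_def
      by (intro Bochner_Integration.integral_cong refl)
         (simp add: scaleR_conv_of_real mult_ac cis_mult algebra_simps)
    also have "\<dots> = tent z *\<^sub>R cis (a * u * z) * L (a * z)"
      unfolding L_def by (rule integral_mult_right_zero)
    finally show ?thesis by simp
  qed
  have outer: "(\<integral>z. f z x \<partial>lborel) = of_real (b x * fejer (a * (u - x)))" for x
  proof -
    have "(\<integral>z. f z x \<partial>lborel) = (\<integral>z. b x *\<^sub>R (tent z *\<^sub>R cis (z * (a * (u - x)))) \<partial>lborel)"
      unfolding f_def by (simp only: scaleR_scaleR mult.commute)
    also have "\<dots> = b x *\<^sub>R (\<integral>z. tent z *\<^sub>R cis (z * (a * (u - x))) \<partial>lborel)"
      by (rule integral_scaleR_right)
    also have "\<dots> = of_real (b x * fejer (a * (u - x)))"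
      unfolding fourier_tent by (simp add: scaleR_conv_of_real)
    finally show ?thesis .
  qed
  show ?A
    using lborel_pair.integrable_fst'[OF f_integrable] by (simp add: inner)
  show ?B
    using lborel_pair.Fubini_integral[OF f_integrable] by (simp add: inner outer del: of_real_mult)
qed

section \<open>Laplace transforms up to the boundary\<close>

lemma integrable_indicator_exp_minus:
  assumes "a > 0"
  shows "integrable lborel (\<lambda>x::real. indicator {c..} x * exp (-(a * x)))"
proof -
  have "(\<lambda>x. exp (- a * x)) absolutely_integrable_on {c..}"
    by (intro nonnegative_absolutely_integrable_1 integrable_on_exp_minus_to_infinity assms) auto
  hence "integrable lebesgue (\<lambda>x. indicator {c..} x * exp (-(a * x)))"
    by (simp add: set_integrable_def)
  thus ?thesis
    by (subst (asm) integrable_completion) simp_all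
qed

text \<open>
  The pole \<open>1 / s\<close> is itself a Laplace transform. This lets the principal part \<open>A / s\<close> be treated by the
  same averaging identity as the function under study.
\<close>

lemma laplace_indicator:
  fixes s :: complex
  assumes s: "Re s > 0"
  shows "integrable lborel (\<lambda>x. indicator {0..} x *\<^sub>R exp (-(s * of_real x)))" (is "integrable _ ?f")
    and "(\<integral>x. indicator {0..} x *\<^sub>R exp (-(s * of_real x)) \<partial>lborel) = 1 / s"
proof -
  show int: "integrable lborel ?f"
    by (rule Bochner_Integration.integrable_bound[OF integrable_indicator_exp_minus[OF s, of 0]]) auto
  have [simp]: "s \<noteq> 0" using s by auto
  have "(\<integral>x. indicator {..y} x *\<^sub>R ?f x \<partial>lborel) = 1 / s - exp (-(s * of_real y)) / s" if "y \<ge> 0" for y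
  proof -
    have "(\<integral>x. indicator {..y} x *\<^sub>R ?f x \<partial>lborel) = (\<integral>x. indicator {0..y} x *\<^sub>R exp (-(s * of_real x)) \<partial>lborel)"
      by (intro Bochner_Integration.integral_cong) (auto simp: indicator_def)
    also have "\<dots> = - exp (-(s * of_real y)) / s - (- exp (-(s * of_real 0)) / s)"
    proof (rule integral_FTC_atLeastAtMost)
      fix x :: real
      have "((\<lambda>w. - exp (-(s * w)) / s) has_field_derivative exp (-(s * of_real x))) (at (of_real x))"
        by (auto intro!: derivative_eq_intros)
      thus "((\<lambda>x. - exp (-(s * of_real x)) / s) has_vector_derivative exp (-(s * of_real x))) (at x within {0..y})"
        by (rule has_vector_derivative_real_field[OF has_field_derivative_at_within])
    qed (use that in \<open>auto intro!: continuous_intros\<close>)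
    finally show ?thesis by simp
  qed
  hence ev: "eventually (\<lambda>y. (\<integral>x. indicator {..y} x *\<^sub>R ?f x \<partial>lborel) = 1 / s - exp (-(s * of_real y)) / s) at_top"
    by (rule eventually_at_top_linorderI[of 0])
  have "((\<lambda>y. exp (- (Re s * y))) \<longlongrightarrow> 0) at_top"
  proof (rule filterlim_compose[OF exp_at_bot])
    have "filterlim (\<lambda>y. Re s * y) at_top at_top"
      by (rule filterlim_tendsto_pos_mult_at_top[OF tendsto_const s filterlim_ident])
    thus "filterlim (\<lambda>y. - (Re s * y)) at_bot at_top"
      by (simp only: filterlim_uminus_at_top)
  qed
  hence "((\<lambda>y. norm (exp (-(s * of_real y)))) \<longlongrightarrow> 0) at_top"
    by simp
  hence "((\<lambda>y. exp (-(s * of_real y))) \<longlongrightarrow> 0) at_top"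
    by (rule tendsto_norm_zero_cancel)
  hence "((\<lambda>y. 1 / s - exp (-(s * of_real y)) / s) \<longlongrightarrow> 1 / s - 0 / s) at_top"
    by (intro tendsto_diff tendsto_divide tendsto_const) simp_all
  hence "((\<lambda>y. \<integral>x. indicator {..y} x *\<^sub>R ?f x \<partial>lborel) \<longlongrightarrow> 1 / s - 0 / s) at_top"
    using tendsto_cong[OF ev] by blast
  moreover have "((\<lambda>y. \<integral>x. indicator {..y} x *\<^sub>R ?f x \<partial>lborel) \<longlongrightarrow> integral\<^sup>L lborel ?f) at_top"
    by (rule tendsto_integral_at_top) (use int in auto)
  ultimately have "integral\<^sup>L lborel ?f = 1 / s - 0 / s"
    by (intro tendsto_unique[OF trivial_limit_at_top_linorder])
  thus "(\<integral>x. ?f x \<partial>lborel) = 1 / s"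
    by simp
qed

text \<open>
  On a vertical strip the exponential is dominated by the sum of its values on the two edges, whatever
  the sign of \<open>x\<close>.
\<close>

lemma continuous_on_laplace:
  fixes b :: "real \<Rightarrow> real"
  assumes [measurable]: "b \<in> borel_measurable borel" and nonneg: "\<And>x. b x \<ge> 0"
    and int: "\<And>\<epsilon>. \<epsilon> > 0 \<Longrightarrow> integrable lborel (\<lambda>x. b x * exp (-(\<epsilon> * x)))"
  shows "continuous_on {s. Re s > 0} (\<lambda>s. \<integral>x. b x *\<^sub>R exp (-(s * of_real x)) \<partial>lborel)"
    (is "continuous_on _ ?F")
proof -
  have strip: "continuous_on {s. \<alpha> < Re s \<and> Re s < \<beta>} ?F" if "0 < \<alpha>" "0 < \<beta>" for \<alpha> \<beta>
  proof (rule continuous_on_sequentiallyI)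
    fix u a assume u: "\<forall>n. u n \<in> {s. \<alpha> < Re s \<and> Re s < \<beta>}" "u \<longlonglongrightarrow> a"
    show "(\<lambda>n. ?F (u n)) \<longlonglongrightarrow> ?F a"
    proof (rule integral_dominated_convergence)
      show "integrable lborel (\<lambda>x. b x * exp (-(\<alpha> * x)) + b x * exp (-(\<beta> * x)))"
        using int that by simp
      have "exp (-(t * x)) \<le> exp (-(\<alpha> * x)) + exp (-(\<beta> * x))" if "\<alpha> < t" "t < \<beta>" for t x :: real
      proof (cases "x \<ge> 0")
        case True
        hence "\<alpha> * x \<le> t * x" using that by (intro mult_right_mono) auto
        thus ?thesis by (simp add: add_increasing2)
      next
        case False
        hence "\<beta> * x \<le> t * x" using that by (intro mult_right_mono_neg) auto
        thus ?thesis by (simp add: add_increasing)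
      qed
      thus "AE x in lborel. norm (b x *\<^sub>R exp (-(u n * of_real x))) \<le> b x * exp (-(\<alpha> * x)) + b x * exp (-(\<beta> * x))" for n
        using u(1) nonneg by (auto simp: distrib_left [symmetric] intro!: mult_left_mono)
      show "AE x in lborel. (\<lambda>n. b x *\<^sub>R exp (-(u n * of_real x))) \<longlonglongrightarrow> b x *\<^sub>R exp (-(a * of_real x))"
        using u(2) by (intro AE_I2 tendsto_intros)
    qed measurable
  qed
  have "isCont ?F s" if "Re s > 0" for s
  proof -
    let ?S = "{w. Re s / 2 < Re w \<and> Re w < Re s + 1}"
    have "open ?S"
      by (intro open_Collect_conj open_halfspace_Re_gt open_halfspace_Re_lt)
    moreover have "continuous_on ?S ?F"
      using that by (intro strip) auto
    ultimately show ?thesis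
      using that by (auto simp: continuous_on_eq_continuous_at)
  qed
  thus ?thesis
    by (auto intro!: continuous_at_imp_continuous_on)
qed

text \<open>
  For \<open>\<epsilon> > 0\<close> the averaging identity applies to the damped functions \<open>B x * exp (- \<epsilon> * x)\<close> and
  \<open>A * exp (- \<epsilon> * x)\<close> on the half-line, and the difference of their transforms on the line \<open>Re s = \<epsilon>\<close> is \<open>H\<close>.
  As \<open>\<epsilon>\<close> tends to \<open>0\<close>, the \<open>H\<close>-term converges because only a compact part of the boundary is seen, where
  \<open>H\<close> is bounded; the term for \<open>A\<close> converges by domination. The remaining term has a nonnegative
  integrand and a convergent integral, so monotone convergence gives the integrability of the
  undamped average, which cannot be assumed beforehand.
\<close>

lemma fejer_mean_boundary:
  fixes B :: "real \<Rightarrow> real" and H :: "complex \<Rightarrow> complex" and A \<eta> a u c :: real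
  assumes meas [measurable]: "B \<in> borel_measurable borel" and nonneg: "\<And>x. B x \<ge> 0"
    and supp: "\<And>x. x < c \<Longrightarrow> B x = 0"
    and \<eta>: "\<eta> > 0" and a: "a > 0"
    and int: "\<And>\<epsilon>. 0 < \<epsilon> \<Longrightarrow> \<epsilon> < \<eta> \<Longrightarrow> integrable lborel (\<lambda>x. B x * exp (-(\<epsilon> * x)))"
    and cont: "continuous_on {s. 0 \<le> Re s \<and> Re s < \<eta>} H"
    and decomp: "\<And>s :: complex. 0 < Re s \<Longrightarrow> Re s < \<eta> \<Longrightarrow>
        (\<integral>x. B x *\<^sub>R exp (-(s * of_real x)) \<partial>lborel) = A / s + H s"
  shows "integrable lborel (\<lambda>x. B x * fejer (a * (u - x)))"
    and "complex_of_real (\<integral>x. B x * fejer (a * (u - x)) \<partial>lborel) =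
           of_real (A * (\<integral>x. indicator {0..} x * fejer (a * (u - x)) \<partial>lborel)) +
           (\<integral>z. tent z *\<^sub>R H (\<i> * (a * z)) * cis ((a * u) * z) \<partial>lborel)"
proof -
  define E where "E = (\<lambda>\<epsilon> z. tent z *\<^sub>R (cis (a * u * z) * H (of_real \<epsilon> + \<i> * (a * z))))"
  define J where "J = (\<lambda>b :: real \<Rightarrow> real. \<integral>x. b x * fejer (a * (u - x)) \<partial>lborel)"
  define damp where "damp = (\<lambda>b \<epsilon> x :: real. b x * exp (-(\<epsilon> * x)))"
  let ?one = "indicator {0..} :: real \<Rightarrow> real"
  have int_fejer: "integrable lborel (\<lambda>x. fejer (a * (u - x)))"
    using lborel_integrable_real_affine[OF integrable_fejer, of "-a" "a * u"] a
    by (simp add: algebra_simps)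

  have H_cont: "continuous_on UNIV (\<lambda>z. H (of_real \<epsilon> + \<i> * (a * z)))" if "0 \<le> \<epsilon>" "\<epsilon> < \<eta>" for \<epsilon>
    by (rule continuous_on_compose2[OF cont]) (use that in \<open>auto intro!: continuous_intros\<close>)
  have E_cont: "continuous_on UNIV (E \<epsilon>)" if "0 \<le> \<epsilon>" "\<epsilon> < \<eta>" for \<epsilon>
    unfolding E_def by (intro continuous_intros H_cont that)

  have key: "complex_of_real (J (damp B \<epsilon>)) = of_real (A * J (damp ?one \<epsilon>)) + (\<integral>z. E \<epsilon> z \<partial>lborel)"
    if \<epsilon>: "0 < \<epsilon>" "\<epsilon> < \<eta>" for \<epsilon>
  proof -
    have exp_eq: "exp (-((of_real \<epsilon> + \<i> * y) * of_real x)) = exp (-(\<epsilon> * x)) *\<^sub>R cis (-(y * x))" for x y :: real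
      by (simp add: cis_conv_exp scaleR_conv_of_real exp_of_real[symmetric] exp_add[symmetric] algebra_simps)
    define L where "L = (\<lambda>b y. \<integral>x. damp b \<epsilon> x *\<^sub>R cis (-(y * x)) \<partial>lborel)"
    have L: "L b y = (\<integral>x. b x *\<^sub>R exp (-((of_real \<epsilon> + \<i> * y) * of_real x)) \<partial>lborel)" for b y
      unfolding L_def damp_def exp_eq by simp
    have LB: "L B y = A * L ?one y + H (of_real \<epsilon> + \<i> * y)" for y
      unfolding L using decomp[where s = "of_real \<epsilon> + \<i> * of_real y"] laplace_indicator(2)[where s = "of_real \<epsilon> + \<i> * of_real y"] \<epsilon>
      by simp
    have iB: "integrable lborel (damp B \<epsilon>)" and i1: "integrable lborel (damp ?one \<epsilon>)"
      using int[OF \<epsilon>] integrable_indicator_exp_minus[OF \<epsilon>(1), of 0] by (simp_all add: damp_def)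
    define P where "P = (\<lambda>b z. tent z *\<^sub>R (cis (a * u * z) * L b (a * z)))"
    have P: "integrable lborel (P b)" "(\<integral>z. P b z \<partial>lborel) = of_real (J (damp b \<epsilon>))"
      if "integrable lborel (damp b \<epsilon>)" for b
      using fejer_fubini[OF that, of a u] by (simp_all add: P_def L_def J_def)
    have "E \<epsilon> z = P B z - A * P ?one z" for z
      unfolding E_def P_def LB by (simp add: scaleR_conv_of_real algebra_simps)
    hence "(\<integral>z. E \<epsilon> z \<partial>lborel) = J (damp B \<epsilon>) - A * J (damp ?one \<epsilon>)"
      using P[OF iB] P[OF i1] by simp
    thus ?thesis by simp
  qed

  \<comment> \<open>Monotone convergence below asks for a decreasing sequence.\<close>
  define e where "e = (\<lambda>n. \<eta> / real (n + 2))"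
  have e: "0 < e n" "e n < \<eta>" "e n \<le> \<eta> / 2" for n
  proof -
    show "0 < e n" using \<eta> by (simp add: e_def)
    show "e n \<le> \<eta> / 2"
      unfolding e_def using \<eta> by (intro divide_left_mono) auto
    also have "\<dots> < \<eta>" using \<eta> by simp
    finally show "e n < \<eta>" .
  qed
  have e_lim: "e \<longlonglongrightarrow> 0"
    unfolding e_def by (intro LIMSEQ_ignore_initial_segment lim_const_over_n)
  have e_anti: "e m \<le> e n" if "n \<le> m" for m n
    using \<eta> that by (auto simp: e_def intro!: divide_left_mono)

  have E_lim: "(\<lambda>n. \<integral>z. E (e n) z \<partial>lborel) \<longlonglongrightarrow> (\<integral>z. E 0 z \<partial>lborel)"
  proof -
    define K where "K = (\<lambda>(t, z). complex_of_real t + \<i> * of_real z) ` ({0..\<eta> / 2} \<times> {-a..a})"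
    have "compact K"
      unfolding K_def case_prod_unfold
      by (intro compact_continuous_image compact_Times continuous_intros) auto
    moreover have "K \<subseteq> {s. 0 \<le> Re s \<and> Re s < \<eta>}"
      using \<eta> by (auto simp: K_def)
    ultimately have "compact (H ` K)"
      using cont by (intro compact_continuous_image) (auto intro: continuous_on_subset)
    then obtain M where M: "\<And>w. w \<in> K \<Longrightarrow> norm (H w) \<le> M"
      by (metis compact_imp_bounded bounded_iff imageI)
    show ?thesis
    proof (rule integral_dominated_convergence)
      show "integrable lborel (\<lambda>z. tent z * M)"
        using integrable_tent by simp
      show "E 0 \<in> borel_measurable lborel" "\<And>n. E (e n) \<in> borel_measurable lborel"
        using E_cont[of 0] E_cont[OF less_imp_le] e \<eta> by (auto intro!: borel_measurable_continuous_onI)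
      show "AE z in lborel. norm (E (e n) z) \<le> tent z * M" for n
      proof (intro AE_I2)
        fix z :: real
        show "norm (E (e n) z) \<le> tent z * M"
        proof (cases "\<bar>z\<bar> \<ge> 1")
          case True
          thus ?thesis by (simp add: E_def tent_eq_0)
        next
          case False
          hence "\<bar>a * z\<bar> \<le> a"
            using a by (simp add: abs_mult)
          hence "of_real (e n) + \<i> * of_real (a * z) \<in> K"
            unfolding K_def using e[of n] by (intro image_eqI[of _ _ "(e n, a * z)"]) auto
          hence "norm (H (of_real (e n) + \<i> * of_real (a * z))) \<le> M"
            by (rule M)
          thus ?thesis
            by (simp add: E_def norm_mult tent_nonneg mult_left_mono)
        qed
      qed
      show "AE z in lborel. (\<lambda>n. E (e n) z) \<longlonglongrightarrow> E 0 z"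
      proof (intro AE_I2)
        fix z :: real
        have "(\<lambda>n. of_real (e n) + \<i> * of_real (a * z)) \<longlonglongrightarrow> of_real 0 + \<i> * of_real (a * z)"
          by (intro tendsto_intros e_lim)
        hence "(\<lambda>n. H (of_real (e n) + \<i> * of_real (a * z))) \<longlonglongrightarrow> H (of_real 0 + \<i> * of_real (a * z))"
          by (rule continuous_on_tendsto_compose[OF cont]) (use e \<eta> in \<open>auto simp: less_imp_le\<close>)
        thus "(\<lambda>n. E (e n) z) \<longlonglongrightarrow> E 0 z"
          unfolding E_def by (intro tendsto_intros)
      qed
    qed
  qed

  have damp_lim: "(\<lambda>n. damp b (e n) x * fejer (a * (u - x))) \<longlonglongrightarrow> b x * fejer (a * (u - x))" for b x
  proof -
    have "(\<lambda>n. damp b (e n) x * fejer (a * (u - x))) \<longlonglongrightarrow> b x * exp (-(0 * x)) * fejer (a * (u - x))"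
      unfolding damp_def by (intro tendsto_intros e_lim)
    thus ?thesis by simp
  qed

  have one_lim: "(\<lambda>n. J (damp ?one (e n))) \<longlonglongrightarrow> J ?one"
    unfolding J_def
  proof (rule integral_dominated_convergence[OF _ _ int_fejer])
    show "AE x in lborel. norm (damp ?one (e n) x * fejer (a * (u - x))) \<le> fejer (a * (u - x))" for n
      using e[of n] by (auto simp: damp_def abs_mult indicator_def fejer_nonneg intro!: mult_left_le_one_le)
  qed (use damp_lim in \<open>auto simp: damp_def\<close>)

  have B_lim: "(\<lambda>n. J (damp B (e n))) \<longlonglongrightarrow> A * J ?one + Re (\<integral>z. E 0 z \<partial>lborel)"
  proof -
    have "J (damp B (e n)) = A * J (damp ?one (e n)) + Re (\<integral>z. E (e n) z \<partial>lborel)" for n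
      using arg_cong[OF key[OF e(1,2)[of n]], of Re] by simp
    thus ?thesis
      by (simp only:) (intro tendsto_intros one_lim E_lim)
  qed

  have im0: "Im (\<integral>z. E 0 z \<partial>lborel) = 0"
  proof -
    have "Im (\<integral>z. E (e n) z \<partial>lborel) = 0" for n
      using arg_cong[OF key[OF e(1,2)[of n]], of Im] by simp
    thus ?thesis
      using tendsto_Im[OF E_lim] by (simp only: LIMSEQ_const_iff)
  qed

  have B_conv: "integrable lborel (\<lambda>x. B x * fejer (a * (u - x))) \<and> J B = A * J ?one + Re (\<integral>z. E 0 z \<partial>lborel)"
  proof -
    \<comment> \<open>The factor turns the damping into \<open>exp (- \<epsilon> * (x - c))\<close>, which increases as \<open>\<epsilon>\<close>
       decreases on the whole support of \<open>B\<close>, even if \<open>c\<close> is negative.\<close>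
    define f where "f = (\<lambda>n x. exp (e n * c) * (damp B (e n) x * fejer (a * (u - x))))"
    have f_eq: "f n x = exp (-(e n * (x - c))) * (B x * fejer (a * (u - x)))" for n x
      by (simp add: f_def damp_def right_diff_distrib exp_diff exp_minus field_simps)
    have int_f: "integrable lborel (f n)" for n
    proof -
      have "integrable lborel (\<lambda>x. damp B (e n) x * fejer (a * (u - x)))"
      proof (rule Bochner_Integration.integrable_bound[OF int[OF e(1,2)[of n]]])
        show "AE x in lborel. norm (damp B (e n) x * fejer (a * (u - x))) \<le> norm (B x * exp (-(e n * x)))"
          by (auto simp: damp_def abs_mult fejer_nonneg fejer_le_1 intro!: mult_left_le)
      qed (auto simp: damp_def)
      thus ?thesis unfolding f_def by simp
    qed
    have mono: "mono (\<lambda>n. f n x)" for x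
    proof (cases "x < c")
      case False
      show ?thesis
      proof (intro monoI)
        fix m n :: nat assume "m \<le> n"
        hence "exp (-(e m * (x - c))) \<le> exp (-(e n * (x - c)))"
          using False e_anti by (simp add: mult_right_mono)
        thus "f m x \<le> f n x"
          unfolding f_eq by (rule mult_right_mono) (simp add: nonneg fejer_nonneg)
      qed
    qed (auto simp: f_eq supp intro!: monoI)
    have exp_lim: "(\<lambda>n. exp (e n * c)) \<longlonglongrightarrow> 1"
      using tendsto_exp[OF tendsto_mult_right[OF e_lim, of c]] by simp
    have pointwise: "(\<lambda>n. f n x) \<longlonglongrightarrow> B x * fejer (a * (u - x))" for x
      unfolding f_def using tendsto_mult[OF exp_lim damp_lim[of B x]] by simp
    have lim: "(\<lambda>n. integral\<^sup>L lborel (f n)) \<longlonglongrightarrow> A * J ?one + Re (\<integral>z. E 0 z \<partial>lborel)"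
      using tendsto_mult[OF exp_lim B_lim] unfolding f_def J_def by simp
    have "AE x in lborel. mono (\<lambda>n. f n x)" "\<And>n. AE x in lborel. 0 \<le> f n x"
      "AE x in lborel. (\<lambda>n. f n x) \<longlonglongrightarrow> B x * fejer (a * (u - x))"
      using mono pointwise by (auto simp: f_eq nonneg fejer_nonneg)
    note MC = integral_monotone_convergence_nonneg[OF int_f this lim]
    show ?thesis
      using MC by (simp add: J_def)
  qed
  thus "integrable lborel (\<lambda>x. B x * fejer (a * (u - x)))" by blast
  have "complex_of_real (J B) = of_real (A * J ?one) + (\<integral>z. E 0 z \<partial>lborel)"
    using B_conv im0 by (simp add: complex_eq_iff)
  also have "(\<integral>z. E 0 z \<partial>lborel) = (\<integral>z. tent z *\<^sub>R H (\<i> * (a * z)) * cis ((a * u) * z) \<partial>lborel)"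
    unfolding E_def by (intro Bochner_Integration.integral_cong) (auto simp: mult_ac)
  finally show "complex_of_real (\<integral>x. B x * fejer (a * (u - x)) \<partial>lborel) =
           of_real (A * (\<integral>x. indicator {0..} x * fejer (a * (u - x)) \<partial>lborel)) +
           (\<integral>z. tent z *\<^sub>R H (\<i> * (a * z)) * cis ((a * u) * z) \<partial>lborel)"
    unfolding J_def .
qed

section \<open>The Wiener-Ikehara theorem\<close>

text \<open>
  The total mass appears on both sides of the final comparison and cancels; its positivity is what
  permits the division. On \<open>[pi / 2, pi]\<close> the cosine is not positive, which bounds the kernel from
  below.
\<close>

lemma fejer_mass_pos: "(\<integral>x. fejer x \<partial>lborel) > 0"
proof -
  have "0 < 2 / pi\<^sup>2 * (pi / 2)" by simp
  also have "\<dots> = (\<integral>x. indicator {pi/2..pi} x * (2 / pi\<^sup>2) \<partial>lborel)"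
    by simp
  also have "\<dots> \<le> (\<integral>x. fejer x \<partial>lborel)"
  proof (rule integral_mono[OF _ integrable_fejer])
    fix x :: real
    show "indicator {pi/2..pi} x * (2 / pi\<^sup>2) \<le> fejer x"
    proof (cases "x \<in> {pi/2..pi}")
      case True
      hence x: "pi / 2 \<le> x" "x \<le> pi" by auto
      hence "0 < x" using pi_half_gt_zero by linarith
      note x = this x
      have "cos x \<le> cos (pi / 2)"
        using x by (intro cos_monotone_0_pi_le) auto
      hence "2 * 1 / pi\<^sup>2 \<le> 2 * (1 - cos x) / x\<^sup>2"
        using x by (intro frac_le mult_left_mono power_mono) auto
      thus ?thesis using True x by (simp add: fejer_def)
    qed (simp add: fejer_nonneg)
  qed simp
  finally show ?thesis .
qed

lemma integral_real_affine_reflect: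
  fixes g :: "real \<Rightarrow> real"
  assumes a: "a > 0"
  shows "(\<integral>x. g (a * (u - x)) \<partial>lborel) = (\<integral>x. g x \<partial>lborel) / a"
    and "integrable lborel g \<Longrightarrow> integrable lborel (\<lambda>x. g (a * (u - x)))"
proof -
  have eq: "g (a * (u - x)) = g (a * u + (-a) * x)" for x
    by (simp add: algebra_simps)
  show "(\<integral>x. g (a * (u - x)) \<partial>lborel) = (\<integral>x. g x \<partial>lborel) / a"
    using lborel_integral_real_affine[of "-a" g "a * u"] a unfolding eq by simp
  show "integrable lborel g \<Longrightarrow> integrable lborel (\<lambda>x. g (a * (u - x)))"
    unfolding eq using a by (intro lborel_integrable_real_affine) auto
qed

text \<open>
  The boundary identity at \<open>u \<rightarrow> \<infinity>\<close>: the contribution of \<open>H\<close> is a Fourier integral of a continuous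
  function with compact support and vanishes by the Riemann-Lebesgue lemma, and the half-line in the
  contribution of \<open>A\<close> fills up the whole line.
\<close>

lemma fejer_mean_limit:
  fixes B :: "real \<Rightarrow> real" and H :: "complex \<Rightarrow> complex" and A \<eta> a c :: real
  assumes meas: "B \<in> borel_measurable borel" and nonneg: "\<And>x. B x \<ge> 0"
    and supp: "\<And>x. x < c \<Longrightarrow> B x = 0"
    and \<eta>: "\<eta> > 0" and a: "a > 0"
    and int: "\<And>\<epsilon>. 0 < \<epsilon> \<Longrightarrow> \<epsilon> < \<eta> \<Longrightarrow> integrable lborel (\<lambda>x. B x * exp (-(\<epsilon> * x)))"
    and cont: "continuous_on {s. 0 \<le> Re s \<and> Re s < \<eta>} H"
    and decomp: "\<And>s :: complex. 0 < Re s \<Longrightarrow> Re s < \<eta> \<Longrightarrow>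
        (\<integral>x. B x *\<^sub>R exp (-(s * of_real x)) \<partial>lborel) = A / s + H s"
  shows "((\<lambda>u. \<integral>x. B x * fejer (a * (u - x)) \<partial>lborel) \<longlongrightarrow> A * ((\<integral>x. fejer x \<partial>lborel) / a)) at_top"
proof -
  define R where "R = (\<lambda>u. \<integral>z. tent z *\<^sub>R H (\<i> * (a * z)) * cis (u * z) \<partial>lborel)"
  note boundary = fejer_mean_boundary(2)[where c = c, OF meas nonneg supp \<eta> a int cont decomp]
  have cont': "continuous_on UNIV (\<lambda>z :: real. H (\<i> * (a * z)))"
    by (rule continuous_on_compose2[OF cont]) (use \<eta> in \<open>auto intro!: continuous_intros\<close>)
  have "continuous_on UNIV (\<lambda>z :: real. tent z *\<^sub>R H (\<i> * (a * z)))"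
    by (intro continuous_intros cont')
  hence "(R \<longlongrightarrow> 0) at_top"
    unfolding R_def by (rule riemann_lebesgue_compact_support[where R = 1]) (simp add: tent_eq_0)
  moreover have "filterlim (\<lambda>u. a * u) at_top at_top"
    by (rule filterlim_tendsto_pos_mult_at_top[OF tendsto_const a filterlim_ident])
  ultimately have R_lim: "((\<lambda>u. R (a * u)) \<longlongrightarrow> 0) at_top"
    by (rule filterlim_compose)
  have half: "((\<lambda>u. \<integral>x. indicator {0..} x * fejer (a * (u - x)) \<partial>lborel) \<longlongrightarrow> (\<integral>x. fejer x \<partial>lborel) / a) at_top"
  proof -
    have "(\<integral>x. indicator {0..} x * fejer (a * (u - x)) \<partial>lborel) = (\<integral>x. indicator {..a * u} x *\<^sub>R fejer x \<partial>lborel) / a" for u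
    proof -
      have "indicator {0..} x = (indicator {..a * u} (a * (u - x)) :: real)" for x
        using mult_le_cancel_left_pos[OF a, of "u - x" u] by (simp add: indicator_def)
      thus ?thesis
        using integral_real_affine_reflect(1)[OF a, of "\<lambda>x. indicator {..a * u} x * fejer x" u] by simp
    qed
    moreover have "((\<lambda>u. \<integral>x. indicator {..a * u} x *\<^sub>R fejer x \<partial>lborel) \<longlongrightarrow> (\<integral>x. fejer x \<partial>lborel)) at_top"
      by (rule filterlim_compose[OF tendsto_integral_at_top[OF _ integrable_fejer]])
         (simp, rule filterlim_tendsto_pos_mult_at_top[OF tendsto_const a filterlim_ident])
    ultimately show ?thesis
      using a by (simp only:) (intro tendsto_intros, auto)
  qed
  have "(\<integral>x. B x * fejer (a * (u - x)) \<partial>lborel) =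
          A * (\<integral>x. indicator {0..} x * fejer (a * (u - x)) \<partial>lborel) + Re (R (a * u))" for u
    using arg_cong[OF boundary[of u], of Re] unfolding R_def by simp
  moreover have "((\<lambda>u. A * (\<integral>x. indicator {0..} x * fejer (a * (u - x)) \<partial>lborel) + Re (R (a * u)))
      \<longlongrightarrow> A * ((\<integral>x. fejer x \<partial>lborel) / a) + Re 0) at_top"
    by (rule tendsto_add[OF tendsto_mult[OF tendsto_const half] tendsto_Re[OF R_lim]])
  ultimately show ?thesis by simp
qed

text \<open>
  The Fejer averages of \<open>B\<close> at every scale \<open>1 / a\<close> converge to \<open>A\<close> times the mass of the scaled kernel. To pass
  from averages to point values, \<open>growth\<close> is used as a one-sided Tauberian condition: on a window of
  half-width \<open>h / a\<close>, the values of \<open>B\<close> are at least \<open>exp (- 2 * \<delta> * h / a)\<close> times the value at the right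
  end, and at most \<open>exp (2 * \<delta> * h / a)\<close> times the value at the left end. The window carries the fraction
  \<open>D h / C\<close> of the mass of the kernel. The first estimate bounds \<open>B\<close> from above, in particular \<open>B\<close> is
  bounded; knowing this, the mass outside the window is harmless in the second estimate, which bounds
  \<open>B\<close> from below. Both errors disappear if \<open>h\<close> and \<open>a / h\<close> tend to infinity.
\<close>

theorem wiener_ikehara:
  fixes B :: "real \<Rightarrow> real" and H :: "complex \<Rightarrow> complex" and A \<eta> \<delta> c :: real
  assumes meas [measurable]: "B \<in> borel_measurable borel" and nonneg: "\<And>x. B x \<ge> 0"
    and supp: "\<And>x. x < c \<Longrightarrow> B x = 0"
    and \<delta>: "\<delta> \<ge> 0"
    and growth: "\<And>x y. c \<le> x \<Longrightarrow> x \<le> y \<Longrightarrow> B y \<le> exp (\<delta> * (y - x)) * B x"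
    and \<eta>: "\<eta> > 0"
    and int: "\<And>\<epsilon>. 0 < \<epsilon> \<Longrightarrow> \<epsilon> < \<eta> \<Longrightarrow> integrable lborel (\<lambda>x. B x * exp (-(\<epsilon> * x)))"
    and cont: "continuous_on {s. 0 \<le> Re s \<and> Re s < \<eta>} H"
    and decomp: "\<And>s :: complex. 0 < Re s \<Longrightarrow> Re s < \<eta> \<Longrightarrow>
        (\<integral>x. B x *\<^sub>R exp (-(s * of_real x)) \<partial>lborel) = A / s + H s"
  shows "(B \<longlongrightarrow> A) at_top"
proof -
  define J where "J = (\<lambda>a u. \<integral>x. B x * fejer (a * (u - x)) \<partial>lborel)"
  define C where "C = (\<integral>x. fejer x \<partial>lborel)"
  define W where "W = (\<lambda>h x. indicator {-h..h} x * fejer x)"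
  define D where "D = (\<lambda>h. \<integral>x. W h x \<partial>lborel)"
  have C: "C > 0" unfolding C_def by (rule fejer_mass_pos)
  have W_int: "integrable lborel (W h)" for h
    by (rule Bochner_Integration.integrable_bound[OF integrable_fejer])
       (auto simp: W_def indicator_def)
  have W: "0 \<le> W h x" "W h x \<le> fejer x" for h x
    by (auto simp: W_def indicator_def fejer_nonneg)
  have D_le: "D h \<le> C" for h
    unfolding D_def C_def by (intro integral_mono W_int integrable_fejer W)
  have D_lim: "(D \<longlongrightarrow> C) at_top"
    unfolding D_def C_def
  proof (rule integral_dominated_convergence_at_top[OF _ _ integrable_fejer])
    show "AE x in lborel. ((\<lambda>h. W h x) \<longlongrightarrow> fejer x) at_top"
    proof (intro AE_I2 tendsto_eventually)
      fix x :: real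
      show "\<forall>\<^sub>F h in at_top. W h x = fejer x"
        using eventually_ge_at_top[of "\<bar>x\<bar>"] by eventually_elim (auto simp: W_def indicator_def)
    qed
    show "\<forall>\<^sub>F h in at_top. AE x in lborel. norm (W h x) \<le> fejer x"
      using W by simp
  qed (auto simp: W_def)
  have J_lim: "((\<lambda>u. a * J a u) \<longlongrightarrow> A * C) at_top" if a: "a > 0" for a
    using tendsto_mult[OF tendsto_const[of a] fejer_mean_limit[where c = c, OF meas nonneg supp \<eta> a int cont decomp]] a
    unfolding J_def C_def by simp
  have J_int: "integrable lborel (\<lambda>x. B x * fejer (a * (u - x)))" if a: "a > 0" for a u
    by (rule fejer_mean_boundary(1)[where c = c, OF meas nonneg supp \<eta> a int cont decomp])
  have window: "x \<in> {u - h / a..u + h / a}" if "a > 0" "W h (a * (u - x)) \<noteq> 0" for a h u x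
    using that by (auto simp: W_def indicator_def field_simps split: if_splits)

  have upper: "B v \<le> exp (2 * \<delta> * (h / a)) * (a * J a (v - h / a)) / D h"
    if a: "a > 0" and D: "D h > 0" and h: "h > 0" and v: "v \<ge> c + 2 * (h / a)" for a h v
  proof -
    define u where "u = v - h / a"
    define m where "m = exp (-(2 * \<delta> * (h / a))) * B v"
    have "m * (D h / a) = (\<integral>x. m * W h (a * (u - x)) \<partial>lborel)"
      unfolding D_def using integral_real_affine_reflect(1)[OF a, of "W h" u] by simp
    also have "\<dots> \<le> J a u"
      unfolding J_def
    proof (rule integral_mono[OF _ J_int[OF a]])
      show "integrable lborel (\<lambda>x. m * W h (a * (u - x)))"
        using integral_real_affine_reflect(2)[OF a W_int] by simp
      fix x
      show "m * W h (a * (u - x)) \<le> B x * fejer (a * (u - x))"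
      proof (cases "W h (a * (u - x)) = 0")
        case False
        have x: "u - h / a \<le> x" "x \<le> v"
          using window[OF a False] by (auto simp: u_def)
        have "B v \<le> exp (\<delta> * (v - x)) * B x"
          using x v by (intro growth) (auto simp: u_def)
        also have "\<dots> \<le> exp (2 * \<delta> * (h / a)) * B x"
        proof -
          have "\<delta> * (v - x) \<le> \<delta> * (2 * (h / a))"
            using x \<delta> by (intro mult_left_mono) (auto simp: u_def)
          thus ?thesis by (intro mult_right_mono nonneg) (simp add: mult_ac)
        qed
        finally have "m \<le> B x"
          by (simp add: m_def exp_minus field_simps)
        thus ?thesis
          using W[of h "a * (u - x)"] nonneg[of x] by (intro mult_mono) auto
      qed (simp add: nonneg fejer_nonneg)
    qed
    finally show ?thesis
      using a D by (simp add: u_def m_def exp_minus field_simps)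
  qed

  \<comment> \<open>The choice \<open>a = h\<^sup>2\<close> makes the window wide in units of \<open>1 / a\<close> and narrow in absolute terms.\<close>
  have scaled: "((\<lambda>h. exp (t * \<delta> * (h / h\<^sup>2))) \<longlongrightarrow> 1) at_top" for t :: real
  proof -
    have "h / h\<^sup>2 = inverse h" for h :: real
      by (cases "h = 0") (simp_all add: power2_eq_square divide_inverse)
    hence "((\<lambda>h::real. exp (t * \<delta> * (h / h\<^sup>2))) \<longlongrightarrow> exp (t * \<delta> * 0)) at_top"
      by (simp only:) (intro tendsto_exp tendsto_mult tendsto_const tendsto_inverse_0_at_top filterlim_ident)
    thus ?thesis by simp
  qed

  have less: "eventually (\<lambda>v. B v < M) at_top" if "M > A" for M
  proof -
    have "((\<lambda>h. exp (2 * \<delta> * (h / h\<^sup>2)) * (A * C) / D h) \<longlongrightarrow> 1 * (A * C) / C) at_top"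
      using C by (intro tendsto_intros scaled D_lim) auto
    hence "eventually (\<lambda>h. exp (2 * \<delta> * (h / h\<^sup>2)) * (A * C) / D h < M) at_top"
      using C that by (intro order_tendstoD) auto
    moreover have "eventually (\<lambda>h. D h > 0) at_top"
      using D_lim C by (intro order_tendstoD)
    ultimately obtain h where h: "h > 0" "D h > 0" "exp (2 * \<delta> * (h / h\<^sup>2)) * (A * C) / D h < M"
      using eventually_happens[OF eventually_conj[OF eventually_gt_at_top[of 0] eventually_conj]] by force
    define a where "a = h\<^sup>2"
    have a: "a > 0" using h by (simp add: a_def)
    have "filterlim (\<lambda>v. -(h / a) + v) at_top at_top"
      by (rule filterlim_tendsto_add_at_top[OF tendsto_const filterlim_ident])
    hence "((\<lambda>v. a * J a (-(h / a) + v)) \<longlongrightarrow> A * C) at_top"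
      by (rule filterlim_compose[OF J_lim[OF a]])
    hence lim: "((\<lambda>v. a * J a (v - h / a)) \<longlongrightarrow> A * C) at_top"
      by simp
    have "((\<lambda>v. exp (2 * \<delta> * (h / a)) * (a * J a (v - h / a)) / D h)
        \<longlongrightarrow> exp (2 * \<delta> * (h / a)) * (A * C) / D h) at_top"
      using h by (intro tendsto_divide tendsto_mult[OF _ lim] tendsto_const) auto
    hence "eventually (\<lambda>v. exp (2 * \<delta> * (h / a)) * (a * J a (v - h / a)) / D h < M) at_top"
      using h by (intro order_tendstoD) (auto simp: a_def)
    thus ?thesis
      using eventually_ge_at_top[of "c + 2 * (h / a)"]
      by eventually_elim (use upper[OF a h(2,1)] in force)
  qed

  obtain M where M: "M \<ge> 0" "\<And>x. B x \<le> M"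
  proof -
    obtain v0 where v0: "\<And>v. v \<ge> v0 \<Longrightarrow> B v < A + 1"
      using less[of "A + 1"] by (auto simp: eventually_at_top_linorder)
    define M where "M = \<bar>A + 1\<bar> + exp (\<delta> * \<bar>v0 - c\<bar>) * B c"
    have "B x \<le> M" for x
    proof -
      consider "x < c" | "x \<ge> v0" | "c \<le> x" "x \<le> v0" by linarith
      thus ?thesis
      proof cases
        case 3
        have "B x \<le> exp (\<delta> * (x - c)) * B c"
          using 3 by (intro growth) auto
        also have "\<dots> \<le> exp (\<delta> * \<bar>v0 - c\<bar>) * B c"
          using 3 \<delta> nonneg by (intro mult_right_mono) (auto intro!: mult_left_mono)
        finally show ?thesis by (simp add: M_def)
      qed (use v0[of x] supp[of x] nonneg[of c] in \<open>auto simp: M_def intro!: add_nonneg_nonneg add_increasing2\<close>)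
    qed
    moreover have "M \<ge> 0" by (simp add: M_def nonneg)
    ultimately show ?thesis using that by blast
  qed

  have lower: "exp (-2 * \<delta> * (h / a)) * (a * J a (v + h / a) - M * (C - D h)) / C \<le> B v"
    if a: "a > 0" and h: "h > 0" and v: "v \<ge> c" for a h v
  proof -
    define u where "u = v + h / a"
    define m where "m = exp (2 * \<delta> * (h / a)) * B v"
    \<comment> \<open>\<open>B\<close> is at most \<open>m\<close> on the window and at most \<open>M\<close> outside of it.\<close>
    define g where "g = (\<lambda>x. m * W h x + M * (fejer x - W h x))"
    have g_int: "integrable lborel g"
      unfolding g_def using W_int integrable_fejer by simp
    have "J a u \<le> (\<integral>x. g (a * (u - x)) \<partial>lborel)"
      unfolding J_def
    proof (rule integral_mono[OF J_int[OF a] integral_real_affine_reflect(2)[OF a g_int]])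
      fix x
      show "B x * fejer (a * (u - x)) \<le> g (a * (u - x))"
      proof (cases "W h (a * (u - x)) = 0")
        case True
        thus ?thesis using M by (simp add: g_def fejer_nonneg mult_right_mono)
      next
        case False
        have x: "v \<le> x" "x \<le> u + h / a"
          using window[OF a False] by (auto simp: u_def)
        have "B x \<le> exp (\<delta> * (x - v)) * B v"
          using x v by (intro growth) auto
        also have "\<dots> \<le> m"
        proof -
          have "\<delta> * (x - v) \<le> \<delta> * (2 * (h / a))"
            using x \<delta> by (intro mult_left_mono) (auto simp: u_def)
          thus ?thesis unfolding m_def by (intro mult_right_mono nonneg) (simp add: mult_ac)
        qed
        finally have "B x * fejer (a * (u - x)) \<le> m * fejer (a * (u - x))"
          by (intro mult_right_mono fejer_nonneg)
        moreover have "W h (a * (u - x)) = fejer (a * (u - x))"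
          using False by (auto simp: W_def indicator_def split: if_splits)
        ultimately show ?thesis by (simp add: g_def)
      qed
    qed
    also have "\<dots> = (m * D h + M * (C - D h)) / a"
      unfolding integral_real_affine_reflect(1)[OF a]
      by (simp add: g_def D_def C_def W_int integrable_fejer)
    finally have "a * J a u \<le> m * D h + M * (C - D h)"
      using a by (simp add: field_simps)
    also have "m * D h \<le> m * C"
      by (intro mult_left_mono D_le) (simp add: m_def nonneg)
    finally have "a * J a u - M * (C - D h) \<le> m * C" by simp
    thus ?thesis
      using C by (simp add: m_def u_def exp_minus field_simps)
  qed

  have greater: "eventually (\<lambda>v. B v > L) at_top" if "L < A" for L
  proof -
    have "((\<lambda>h. exp (-2 * \<delta> * (h / h\<^sup>2)) * (A * C - M * (C - D h)) / C) \<longlongrightarrow> 1 * (A * C - M * (C - C)) / C) at_top"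
      using C by (intro tendsto_intros scaled D_lim) auto
    hence "eventually (\<lambda>h. exp (-2 * \<delta> * (h / h\<^sup>2)) * (A * C - M * (C - D h)) / C > L) at_top"
      using C that by (intro order_tendstoD) auto
    then obtain h where h: "h > 0" "exp (-2 * \<delta> * (h / h\<^sup>2)) * (A * C - M * (C - D h)) / C > L"
      using eventually_happens[OF eventually_conj[OF eventually_gt_at_top[of 0]]] by force
    define a where "a = h\<^sup>2"
    have a: "a > 0" using h by (simp add: a_def)
    have "filterlim (\<lambda>v. h / a + v) at_top at_top"
      by (rule filterlim_tendsto_add_at_top[OF tendsto_const filterlim_ident])
    hence "((\<lambda>v. a * J a (h / a + v)) \<longlongrightarrow> A * C) at_top"
      by (rule filterlim_compose[OF J_lim[OF a]])
    hence lim: "((\<lambda>v. a * J a (v + h / a)) \<longlongrightarrow> A * C) at_top"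
      by (simp add: add.commute)
    have "((\<lambda>v. exp (-2 * \<delta> * (h / a)) * (a * J a (v + h / a) - M * (C - D h)) / C)
        \<longlongrightarrow> exp (-2 * \<delta> * (h / a)) * (A * C - M * (C - D h)) / C) at_top"
      using C by (intro tendsto_divide tendsto_mult[OF _ tendsto_diff[OF lim]] tendsto_const) auto
    hence "eventually (\<lambda>v. exp (-2 * \<delta> * (h / a)) * (a * J a (v + h / a) - M * (C - D h)) / C > L) at_top"
      using h by (intro order_tendstoD) (auto simp: a_def)
    thus ?thesis
      using eventually_ge_at_top[of c]
      by eventually_elim (use lower[OF a h(1)] in force)
  qed
  show ?thesis
    using less greater by (intro order_tendstoI)
qed

section \<open>Volumes of tails and the tube zeta function\<close>

lemma exp_substitution:
  fixes f :: "real \<Rightarrow> 'a :: euclidean_space"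
  assumes T: "T > 0" and [measurable]: "f \<in> borel_measurable borel"
  shows "set_integrable lborel {T..} f \<longleftrightarrow>
           integrable lborel (\<lambda>x. indicator {ln T..} x *\<^sub>R exp x *\<^sub>R f (exp x))" (is ?A)
    and "(LINT t:{T..}|lborel. f t) = (\<integral>x. indicator {ln T..} x *\<^sub>R exp x *\<^sub>R f (exp x) \<partial>lborel)" (is ?B)
proof -
  let ?g = "\<lambda>x. exp x *\<^sub>R f (exp x)"
  have img: "exp ` {ln T..} = {T..}"
  proof (intro equalityI subsetI)
    fix t assume "t \<in> {T..}"
    thus "t \<in> exp ` {ln T..}"
      using T by (intro image_eqI[of _ _ "ln t"]) auto
  next
    fix t assume "t \<in> exp ` {ln T..}"
    then obtain x where "t = exp x" "exp (ln T) \<le> exp x" by auto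
    thus "t \<in> {T..}" using T by simp
  qed
  have der: "(exp has_field_derivative exp x) (at x within {ln T..})" for x :: real
    by (auto intro!: derivative_eq_intros)
  have inj: "inj_on exp {ln T..}"
    by (auto simp: inj_on_def)
  have cov: "?g absolutely_integrable_on {ln T..} \<and> integral {ln T..} ?g = b
      \<longleftrightarrow> f absolutely_integrable_on {T..} \<and> integral {T..} f = b" for b
    using has_absolute_integral_change_of_variables_real[of "{ln T..}" exp exp f b, OF _ der inj]
    unfolding img by simp
  have leb1: "set_integrable lborel {T..} f \<longleftrightarrow> f absolutely_integrable_on {T..}"
    unfolding set_integrable_def by (rule integrable_completion [symmetric]) measurable
  have leb2: "set_integrable lborel {ln T..} ?g \<longleftrightarrow> ?g absolutely_integrable_on {ln T..}"
    unfolding set_integrable_def by (rule integrable_completion [symmetric]) measurable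
  show iff: ?A
    using cov leb1 leb2 unfolding set_integrable_def by blast
  show ?B
  proof (cases "set_integrable lborel {T..} f")
    case True
    hence "set_integrable lborel {ln T..} ?g"
      using iff by (simp add: set_integrable_def)
    thus ?thesis
      using True cov[of "integral {T..} f"] leb1 set_borel_integral_eq_integral(2)[of "{T..}" f]
        set_borel_integral_eq_integral(2)[of "{ln T..}" ?g]
      by (simp add: set_lebesgue_integral_def)
  next
    case False
    thus ?thesis
      using iff by (simp add: set_lebesgue_integral_def set_integrable_def not_integrable_integral_eq)
  qed
qed

lemma sets_tail_infty [measurable]:
  "\<Omega> \<in> sets lebesgue \<Longrightarrow> tail_infty t \<Omega> \<in> sets lebesgue"
  unfolding tail_infty_def by (intro sets.Int) auto

lemma tail_infty_antimono: "s \<le> t \<Longrightarrow> tail_infty t \<Omega> \<subseteq> tail_infty s \<Omega>"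
  by (auto simp: tail_infty_def)

definition tail_volume :: "(real ^ 'n) set \<Rightarrow> real \<Rightarrow> real" where
  "tail_volume \<Omega> t = measure lebesgue (tail_infty t \<Omega>)"

text \<open>
  With \<open>t = exp x\<close> this is the ratio \<open>tail_volume \<Omega> t / t powr (N + D)\<close> whose limit is the \<open>D\<close>-dimensional Minkowski
  content, cut off below \<open>t = T\<close>.
\<close>

definition log_tail :: "(real ^ 'n) set \<Rightarrow> real \<Rightarrow> real \<Rightarrow> real \<Rightarrow> real" where
  "log_tail \<Omega> D T x =
     indicator {ln T..} x * exp (-((D + real CARD('n)) * x)) * tail_volume \<Omega> (exp x)"

context
  fixes \<Omega> :: "(real ^ 'n) set"
  assumes \<Omega>: "\<Omega> \<in> sets lebesgue" "emeasure lebesgue \<Omega> < \<infinity>"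
begin

lemma fmeasurable_tail_infty: "tail_infty t \<Omega> \<in> fmeasurable lebesgue"
proof (rule fmeasurableI2[of \<Omega>])
  show "\<Omega> \<in> fmeasurable lebesgue" using \<Omega> by (intro fmeasurableI) auto
qed (use \<Omega> in \<open>auto simp: tail_infty_def\<close>)

lemma emeasure_tail_infty: "emeasure lebesgue (tail_infty t \<Omega>) = ennreal (tail_volume \<Omega> t)"
  unfolding tail_volume_def using fmeasurable_tail_infty[of t] by (simp add: emeasure_eq_measure2)

lemma tail_volume_nonneg: "tail_volume \<Omega> t \<ge> 0"
  by (simp add: tail_volume_def)

lemma tail_volume_antimono: "s \<le> t \<Longrightarrow> tail_volume \<Omega> t \<le> tail_volume \<Omega> s"
  unfolding tail_volume_def
  by (intro measure_mono_fmeasurable tail_infty_antimono fmeasurable_tail_infty) (use \<Omega> in auto)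

lemma borel_measurable_tail_volume [measurable]: "tail_volume \<Omega> \<in> borel_measurable borel"
proof -
  have "mono (\<lambda>t. - tail_volume \<Omega> t)" using tail_volume_antimono by (intro monoI) auto
  hence "(\<lambda>t. - (- tail_volume \<Omega> t)) \<in> borel_measurable borel"
    by (intro borel_measurable_uminus borel_measurable_mono)
  thus ?thesis by simp
qed

text \<open>
  The gap between \<open>r'\<close> and \<open>r\<close>, which comes from the dimension being an infimum, is what makes the zeta
  integrals converge at \<open>Re s = r\<close>.
\<close>

lemma tail_decay:
  assumes "upper_minkowski_dim_infty \<Omega> < ereal r"
  obtains r' where "r' < r" "eventually (\<lambda>t. tail_volume \<Omega> t \<le> t powr (real CARD('n) + r')) at_top"
proof -
  from assms obtain r' where r': "upper_minkowski_content_infty r' \<Omega> = 0" "r' < r"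
    unfolding upper_minkowski_dim_infty_def by (auto simp: INF_less_iff)
  have "eventually (\<lambda>t. emeasure lebesgue (tail_infty t \<Omega>) / ennreal (t powr (real CARD('n) + r')) < 1) at_top"
    using r'(1) unfolding upper_minkowski_content_infty_def by (intro Limsup_lessD) simp
  hence "eventually (\<lambda>t. tail_volume \<Omega> t \<le> t powr (real CARD('n) + r')) at_top"
    using eventually_gt_at_top[of 0]
  proof eventually_elim
    case (elim t)
    hence "ennreal (tail_volume \<Omega> t / t powr (real CARD('n) + r')) < ennreal 1"
      by (simp add: emeasure_tail_infty divide_ennreal tail_volume_nonneg)
    hence "tail_volume \<Omega> t / t powr (real CARD('n) + r') < 1"
      by (subst (asm) ennreal_less_iff) (auto simp: tail_volume_nonneg)
    thus ?case using elim by (simp add: field_simps)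
  qed
  with r'(2) show ?thesis using that by blast
qed

lemma log_tail_nonneg: "log_tail \<Omega> D T x \<ge> 0"
  by (simp add: log_tail_def tail_volume_nonneg)

lemma borel_measurable_log_tail [measurable]: "log_tail \<Omega> D T \<in> borel_measurable borel"
  unfolding log_tail_def by measurable

text \<open>
  The Tauberian condition. It expresses that the volume of the tail is decreasing; the exponent is
  nonnegative precisely when \<open>D \<le> - N\<close>.
\<close>

lemma log_tail_growth:
  assumes "ln T \<le> x" "x \<le> y"
  shows "log_tail \<Omega> D T y \<le> exp (-(D + real CARD('n)) * (y - x)) * log_tail \<Omega> D T x"
proof -
  have "tail_volume \<Omega> (exp y) \<le> tail_volume \<Omega> (exp x)" using assms by (intro tail_volume_antimono) simp
  hence "exp (-((D + real CARD('n)) * y)) * tail_volume \<Omega> (exp y) \<le> exp (-((D + real CARD('n)) * y)) * tail_volume \<Omega> (exp x)"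
    by (intro mult_left_mono) auto
  moreover have "exp (-((D + real CARD('n)) * y)) = exp (-(D + real CARD('n)) * (y - x)) * exp (-((D + real CARD('n)) * x))"
    unfolding exp_add [symmetric] by (simp add: algebra_simps)
  ultimately show ?thesis using assms by (simp only: log_tail_def) simp
qed

text \<open>
  Beyond some \<open>x0\<close> the decay of the tail leaves the exponential rate \<open>\<kappa> = D + \<epsilon> - r'\<close>, which is positive;
  before \<open>x0\<close> the integrand is bounded on a bounded interval.
\<close>

lemma integrable_log_tail:
  assumes dim: "upper_minkowski_dim_infty \<Omega> = ereal D" and \<epsilon>: "\<epsilon> > 0"
  shows "integrable lborel (\<lambda>x. log_tail \<Omega> D T x * exp (-(\<epsilon> * x)))"
proof -
  let ?N = "real CARD('n)"
  obtain r' where r': "r' < D + \<epsilon>" "eventually (\<lambda>t. tail_volume \<Omega> t \<le> t powr (?N + r')) at_top"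
    using tail_decay[of "D + \<epsilon>"] dim \<epsilon> by auto
  have "eventually (\<lambda>x. tail_volume \<Omega> (exp x) \<le> exp x powr (?N + r')) at_top"
    using eventually_compose_filterlim[OF r'(2) exp_at_top] .
  then obtain x0 where x0: "\<And>x. x \<ge> x0 \<Longrightarrow> tail_volume \<Omega> (exp x) \<le> exp x powr (?N + r')"
    by (auto simp: eventually_at_top_linorder)
  define \<kappa> where "\<kappa> = D + \<epsilon> - r'"
  define K where "K = exp (\<bar>D + ?N + \<epsilon>\<bar> * (\<bar>ln T\<bar> + \<bar>x0\<bar>)) * tail_volume \<Omega> 0"
  have "K \<ge> 0" by (simp add: K_def tail_volume_nonneg)
  have "\<kappa> > 0" using r' by (simp add: \<kappa>_def)
  have eq: "log_tail \<Omega> D T x * exp (-(\<epsilon> * x)) = exp (-((D + ?N + \<epsilon>) * x)) * tail_volume \<Omega> (exp x)" if "x \<ge> ln T" for x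
    using that by (simp add: log_tail_def exp_add [symmetric] algebra_simps)
  have bound: "log_tail \<Omega> D T x * exp (-(\<epsilon> * x)) \<le> K * indicator {ln T..x0} x + indicator {ln T..} x * exp (-(\<kappa> * x))" for x
  proof (cases "x \<ge> ln T")
    case T: True
    show ?thesis
    proof (cases "x \<ge> x0")
      case True
      have "exp (-((D + ?N + \<epsilon>) * x)) * tail_volume \<Omega> (exp x) \<le> exp (-((D + ?N + \<epsilon>) * x)) * exp ((?N + r') * x)"
        using x0[OF True] by (intro mult_left_mono) (auto simp: powr_def)
      also have "\<dots> = exp (-(\<kappa> * x))"
        by (simp add: exp_add [symmetric] \<kappa>_def algebra_simps)
      finally show ?thesis
        using T \<open>K \<ge> 0\<close> by (simp add: eq indicator_def)
    next
      case False
      have "-((D + ?N + \<epsilon>) * x) \<le> \<bar>D + ?N + \<epsilon>\<bar> * \<bar>x\<bar>"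
        by (simp add: abs_mult [symmetric])
      also have "\<dots> \<le> \<bar>D + ?N + \<epsilon>\<bar> * (\<bar>ln T\<bar> + \<bar>x0\<bar>)"
        using T False by (intro mult_left_mono) auto
      finally have "exp (-((D + ?N + \<epsilon>) * x)) * tail_volume \<Omega> (exp x) \<le> K"
        unfolding K_def by (intro mult_mono tail_volume_antimono) (auto simp: tail_volume_nonneg)
      thus ?thesis
        using T False by (simp add: eq add_increasing2)
    qed
  qed (simp add: log_tail_def)
  show ?thesis
  proof (rule Bochner_Integration.integrable_bound)
    show "integrable lborel (\<lambda>x. K * indicator {ln T..x0} x + indicator {ln T..} x * exp (-(\<kappa> * x)))"
      using integrable_indicator_exp_minus[OF \<open>\<kappa> > 0\<close>, of "ln T"]
      by (intro Bochner_Integration.integrable_add integrable_mult_right integrable_real_indicator)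
         (auto simp: emeasure_lborel_Icc_eq)
    show "AE x in lborel. norm (log_tail \<Omega> D T x * exp (-(\<epsilon> * x))) \<le>
        norm (K * indicator {ln T..x0} x + indicator {ln T..} x * exp (-(\<kappa> * x)))"
      using bound log_tail_nonneg \<open>K \<ge> 0\<close> by (intro AE_I2) (auto simp: abs_mult)
  qed measurable
qed

text \<open>
  The substitution \<open>t = exp x\<close> turns the Mellin-type integral of the tube zeta function into a Laplace
  transform, centred at the critical abscissa.
\<close>

lemma tube_zeta_eq_laplace:
  assumes T: "T > 0"
  shows "tube_zeta_infty T \<Omega> s = (\<integral>x. log_tail \<Omega> D T x *\<^sub>R exp (-((s - of_real D) * of_real x)) \<partial>lborel)"
proof -
  let ?f = "\<lambda>t::real. complex_of_real t powr (- s - of_nat CARD('n) - 1) * complex_of_real (tail_volume \<Omega> t)"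
  have "tube_zeta_infty T \<Omega> s = (LINT t:{T..}|lborel. ?f t)"
    by (simp add: tube_zeta_infty_def tail_volume_def)
  also have "\<dots> = (\<integral>x. indicator {ln T..} x *\<^sub>R exp x *\<^sub>R ?f (exp x) \<partial>lborel)"
    by (rule exp_substitution(2)[OF T]) measurable
  also have "\<dots> = (\<integral>x. log_tail \<Omega> D T x *\<^sub>R exp (-((s - of_real D) * of_real x)) \<partial>lborel)"
  proof (intro Bochner_Integration.integral_cong refl)
    fix x :: real
    have "complex_of_real (exp x) powr (- s - of_nat CARD('n) - 1) = exp ((- s - of_nat CARD('n) - 1) * x)"
      by (simp add: powr_def mult.commute exp_of_real [symmetric])
    moreover have "complex_of_real (exp x) * exp ((- s - of_nat CARD('n) - 1) * x) = exp ((- s - of_nat CARD('n)) * x)"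
      unfolding exp_of_real [symmetric] exp_add [symmetric] by (rule arg_cong[of _ _ exp]) (simp add: algebra_simps)
    moreover have "complex_of_real (exp (-((D + real CARD('n)) * x))) * exp (-((s - of_real D) * of_real x)) = exp ((- s - of_nat CARD('n)) * x)"
      unfolding exp_of_real [symmetric] exp_add [symmetric] by (rule arg_cong[of _ _ exp]) (simp add: algebra_simps)
    ultimately show "indicator {ln T..} x *\<^sub>R exp x *\<^sub>R ?f (exp x) = log_tail \<Omega> D T x *\<^sub>R exp (-((s - of_real D) * of_real x))"
      by (simp add: log_tail_def scaleR_conv_of_real mult.assoc [symmetric] mult.commute [of _ "complex_of_real (tail_volume \<Omega> (exp x))"])
  qed
  finally show ?thesis .
qed

lemma set_integrable_tube:
  assumes dim: "upper_minkowski_dim_infty \<Omega> = ereal D" and \<sigma>: "\<sigma> > D" and T: "T > 0"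
  shows "set_integrable lborel {T..} (\<lambda>t. t powr (- \<sigma> - real CARD('n) - 1) * tail_volume \<Omega> t)"
proof -
  have "integrable lborel (\<lambda>x. log_tail \<Omega> D T x * exp (-((\<sigma> - D) * x)))"
    using integrable_log_tail[OF dim, of "\<sigma> - D" T] \<sigma> by simp
  also have "(\<lambda>x. log_tail \<Omega> D T x * exp (-((\<sigma> - D) * x))) =
     (\<lambda>x. indicator {ln T..} x *\<^sub>R exp x *\<^sub>R (exp x powr (- \<sigma> - real CARD('n) - 1) * tail_volume \<Omega> (exp x)))"
    by (auto simp: fun_eq_iff log_tail_def powr_def exp_add [symmetric] algebra_simps)
  finally show ?thesis
    by (subst exp_substitution(1)[OF T]) measurable
qed

end

text \<open>
  Continuity ensures that removing the singularities of the meromorphic extension does not change its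
  values in the open half-plane, so that the regular part still describes the zeta function there.
\<close>

lemma continuous_on_tube_zeta:
  fixes \<Omega> :: "(real ^ 'n) set"
  assumes \<Omega>: "\<Omega> \<in> sets lebesgue" "emeasure lebesgue \<Omega> < \<infinity>"
    and dim: "upper_minkowski_dim_infty \<Omega> = ereal D" and T: "T > 0"
  shows "continuous_on {s. Re s > D} (tube_zeta_infty T \<Omega>)"
proof -
  have "continuous_on {s. Re s > 0} (\<lambda>w. \<integral>x. log_tail \<Omega> D T x *\<^sub>R exp (-(w * of_real x)) \<partial>lborel)"
    by (rule continuous_on_laplace[OF borel_measurable_log_tail[OF \<Omega>] log_tail_nonneg[OF \<Omega>] integrable_log_tail[OF \<Omega> dim]])
  hence "continuous_on {s. Re s > D} (\<lambda>s. \<integral>x. log_tail \<Omega> D T x *\<^sub>R exp (-((s - of_real D) * of_real x)) \<partial>lborel)"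
    by (rule continuous_on_compose2) (auto intro!: continuous_intros)
  thus ?thesis
    by (simp add: tube_zeta_eq_laplace[OF \<Omega> T, of _ D, abs_def])
qed

section \<open>The distance zeta function\<close>

text \<open>
  Write \<open>|x| powr p = T powr p + \<integral> p * t powr (p - 1) dt\<close> over \<open>T \<le> t \<le> |x|\<close> with \<open>p = - s - N\<close> and exchange
  the order of integration: for fixed \<open>t \<ge> T\<close>, the points with \<open>|x| \<ge> t\<close> form exactly the tail of radius \<open>t\<close>.
  The exchange is justified by the absolute convergence of the tube zeta integral, which holds to the
  right of \<open>D\<close>.
\<close>

lemma distance_zeta_eq_tube_zeta:
  fixes \<Omega> :: "(real ^ 'n) set"
  assumes \<Omega>: "\<Omega> \<in> sets lebesgue" "emeasure lebesgue \<Omega> < \<infinity>"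
    and dim: "upper_minkowski_dim_infty \<Omega> = ereal D"
    and T: "T > 0" and s: "Re s > D" "Re s < - real CARD('n)"
  defines "p \<equiv> - s - of_nat CARD('n)"
  shows "distance_zeta_infty T \<Omega> s =
           of_real T powr p * of_real (tail_volume \<Omega> T) + p * tube_zeta_infty T \<Omega> s"
proof -
  define M where "M = restrict_space lebesgue (tail_infty T \<Omega>)"
  define f where "f = (\<lambda>(t, x :: real ^ 'n). indicator {T..norm x} t *\<^sub>R (p * of_real t powr (p - 1)))"
  have "Re p > 0" using s by (simp add: p_def)
  have tail: "tail_infty T \<Omega> \<in> sets lebesgue" using \<Omega>(1) by (rule sets_tail_infty)
  have space_M: "space M = tail_infty T \<Omega>"
    using sets.sets_into_space[OF tail] by (simp add: M_def space_restrict_space)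
  have emeasure_M: "emeasure M A = emeasure lebesgue A" if "A \<subseteq> tail_infty T \<Omega>" for A
    unfolding M_def using that tail by (intro emeasure_restrict_space) auto
  interpret M: finite_measure M
    by standard (simp add: space_M emeasure_M emeasure_tail_infty[OF \<Omega>])
  interpret P: pair_sigma_finite lborel M ..
  have norm_meas [measurable]: "norm \<in> borel_measurable M"
    unfolding M_def by (intro measurable_restrict_space1 measurable_completion) simp
  have f_meas: "f \<in> borel_measurable (lborel \<Otimes>\<^sub>M M)"
  proof -
    have [measurable]: "(\<lambda>z. norm (snd z)) \<in> borel_measurable (lborel \<Otimes>\<^sub>M M)"
      by (rule measurable_compose[OF measurable_snd norm_meas])
    have [measurable]: "fst \<in> borel_measurable (lborel \<Otimes>\<^sub>M M)"
      using measurable_fst[of lborel M] by simp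
    have "(\<lambda>t::real. complex_of_real t powr (p - 1)) \<in> borel_measurable borel"
      by measurable
    from measurable_compose[OF _ this, of fst "lborel \<Otimes>\<^sub>M M"]
    have [measurable]: "(\<lambda>z. complex_of_real (fst z) powr (p - 1)) \<in> borel_measurable (lborel \<Otimes>\<^sub>M M)"
      by simp
    have "f = (\<lambda>z. if T \<le> fst z \<and> fst z \<le> norm (snd z) then p * of_real (fst z) powr (p - 1) else 0)"
      by (auto simp: f_def fun_eq_iff indicator_def)
    also have "\<dots> \<in> borel_measurable (lborel \<Otimes>\<^sub>M M)"
      by measurable
    finally show ?thesis .
  qed
  have level: "measure M {x \<in> space M. t \<le> norm x} = tail_volume \<Omega> t" if "t \<ge> T" for t
  proof -
    have "{x \<in> space M. t \<le> norm x} = tail_infty t \<Omega>"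
      using that by (auto simp: space_M tail_infty_def)
    thus ?thesis
      using emeasure_M[OF tail_infty_antimono[OF that]]
      by (simp add: measure_def tail_volume_def)
  qed
  have inner: "(\<integral>x. indicator {T..norm x} t *\<^sub>R c \<partial>M) = (indicator {T..} t * tail_volume \<Omega> t) *\<^sub>R c"
    for t :: real and c :: "'b :: {banach, second_countable_topology}"
  proof (cases "t \<ge> T")
    case True
    have "(\<integral>x. indicator {T..norm x} t *\<^sub>R c \<partial>M) = (\<integral>x. indicator {x \<in> space M. t \<le> norm x} x *\<^sub>R c \<partial>M)"
      using True by (intro Bochner_Integration.integral_cong) (auto simp: indicator_def)
    also have "\<dots> = measure M {x \<in> space M. t \<le> norm x} *\<^sub>R c"
      by (intro has_bochner_integral_integral_eq has_bochner_integral_indicator) (auto simp: M.emeasure_finite top.not_eq_extremum [symmetric])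
    finally show ?thesis using True by (simp add: level)
  qed (auto simp: indicator_def)
  have f_int: "integrable (lborel \<Otimes>\<^sub>M M) f"
  proof (rule P.Fubini_integrable[OF f_meas])
    have "(\<integral>x. norm (f (t, x)) \<partial>M) = norm p * (indicator {T..} t * (t powr (- Re s - real CARD('n) - 1) * tail_volume \<Omega> t))" for t
    proof -
      have "(\<integral>x. norm (f (t, x)) \<partial>M) = (\<integral>x. indicator {T..norm x} t *\<^sub>R norm (p * of_real t powr (p - 1)) \<partial>M)"
        by (simp add: f_def)
      also have "\<dots> = (indicator {T..} t * tail_volume \<Omega> t) *\<^sub>R norm (p * of_real t powr (p - 1))"
        by (rule inner)
      also have "\<dots> = norm p * (indicator {T..} t * (t powr (- Re s - real CARD('n) - 1) * tail_volume \<Omega> t))"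
        using T by (cases "t \<ge> T") (auto simp: norm_mult norm_powr_real_powr p_def)
      finally show ?thesis .
    qed
    thus "integrable lborel (\<lambda>t. \<integral>x. norm (f (t, x)) \<partial>M)"
      using set_integrable_tube[OF \<Omega> dim s(1) T] by (simp add: set_integrable_def)
    have "integrable M (\<lambda>x. f (t, x))" for t
      by (rule M.integrable_const_bound[where B = "norm (p * of_real t powr (p - 1))"])
         (auto simp: f_def indicator_def)
    thus "AE t in lborel. integrable M (\<lambda>x. f (t, x))" by simp
  qed
  have radial: "(\<integral>t. f (t, x) \<partial>lborel) = of_real (norm x) powr p - of_real T powr p" if "x \<in> space M" for x
  proof -
    have x: "T \<le> norm x" using that by (auto simp: space_M tail_infty_def)
    have "(\<integral>t. indicator {T..norm x} t *\<^sub>R (p * of_real t powr (p - 1)) \<partial>lborel)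
        = of_real (norm x) powr p - of_real T powr p"
    proof (rule integral_FTC_atLeastAtMost[OF x])
      fix t assume "T \<le> t"
      hence "((\<lambda>z. z powr p) has_field_derivative p * of_real t powr (p - 1)) (at (of_real t))"
        using T by (intro has_field_derivative_powr) (auto simp: complex_nonpos_Reals_iff)
      thus "((\<lambda>t. of_real t powr p) has_vector_derivative p * of_real t powr (p - 1)) (at t within {T..norm x})"
        by (rule has_vector_derivative_real_field[OF has_field_derivative_at_within])
    qed (use T in \<open>auto intro!: continuous_intros simp: complex_nonpos_Reals_iff\<close>)
    thus ?thesis by (simp add: f_def)
  qed
  have int: "integrable M (\<lambda>x. of_real (norm x) powr p - of_real T powr p)"
    using P.integrable_snd[of "\<lambda>t x. f (t, x)"] f_int radial
    by (simp cong: Bochner_Integration.integrable_cong)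
  have "(\<integral>x. f (t, x) \<partial>M) = (indicator {T..} t * tail_volume \<Omega> t) *\<^sub>R (p * of_real t powr (p - 1))" for t
    unfolding f_def case_prod_conv by (rule inner)
  hence "p * tube_zeta_infty T \<Omega> s = (\<integral>t. (\<integral>x. f (t, x) \<partial>M) \<partial>lborel)"
    unfolding tube_zeta_infty_def set_lebesgue_integral_def integral_mult_right_zero [symmetric]
    by (intro Bochner_Integration.integral_cong)
       (auto simp: p_def tail_volume_def scaleR_conv_of_real mult_ac)
  also have "\<dots> = (\<integral>x. (\<integral>t. f (t, x) \<partial>lborel) \<partial>M)"
    using P.Fubini_integral[of "\<lambda>t x. f (t, x)"] f_int by simp
  also have "\<dots> = (\<integral>x. of_real (norm x) powr p - of_real T powr p \<partial>M)"
    by (intro Bochner_Integration.integral_cong radial refl)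
  finally have tube: "p * tube_zeta_infty T \<Omega> s = (\<integral>x. of_real (norm x) powr p - of_real T powr p \<partial>M)" .
  have "distance_zeta_infty T \<Omega> s = (\<integral>x. of_real (norm x) powr p \<partial>M)"
    unfolding distance_zeta_infty_def set_lebesgue_integral_def M_def p_def
    using tail by (subst integral_restrict_space) auto
  also have "\<dots> = (\<integral>x. (of_real (norm x) powr p - of_real T powr p) + of_real T powr p \<partial>M)"
    by simp
  also have "\<dots> = p * tube_zeta_infty T \<Omega> s + measure M (space M) *\<^sub>R of_real T powr p"
    unfolding tube by (subst Bochner_Integration.integral_add[OF int]) auto
  also have "measure M (space M) = tail_volume \<Omega> T"
    using emeasure_M[of "tail_infty T \<Omega>"] by (simp add: measure_def tail_volume_def space_M)
  finally show ?thesis by (simp add: scaleR_conv_of_real mult.commute add.commute)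
qed

section \<open>The regular part at a simple pole\<close>

text \<open>
  Subtracting the principal part at the simple pole leaves a meromorphic function with a limit at every
  point of the closed strip: at the pole by the definition of the derivative of the analytic factor
  \<open>(z - a) * g z\<close>, at the other points of the line since they are no poles, and inside the strip
  because \<open>f\<close> is continuous. Removing the singularities thus gives a function that is
  analytic, hence continuous, up to the line, and that agrees with \<open>f\<close> inside.
\<close>

lemma simple_pole_regular_part:
  assumes ext: "meromorphic_extension f a U g"
    and pole: "only_pole_simple g U (of_real a)"
    and cont: "continuous_on {s. Re s > a \<and> Re s < b} f"
  shows "residue g (of_real a) \<noteq> 0"
    and "\<exists>H. continuous_on {s. Re s \<ge> a \<and> Re s < b} H \<and>
           (\<forall>s. Re s > a \<and> Re s < b \<longrightarrow> f s = residue g (of_real a) / (s - of_real a) + H s)"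
proof -
  define z0 where "z0 = complex_of_real a"
  define r where "r = residue g z0"
  define h where "h = (\<lambda>z. g z - r / (z - z0))"
  have U: "open U" "{s. Re s = a} \<subseteq> U" and g: "g meromorphic_on {s. Re s > a} \<union> U"
    and gf: "\<And>s. Re s > a \<Longrightarrow> g s = f s"
    using ext by (auto simp: meromorphic_extension_def)
  have poles: "is_pole g z \<longleftrightarrow> z = z0" if "z \<in> U" for z
    using pole that unfolding only_pole_simple_def z0_def by blast
  have z0U: "z0 \<in> U" using U by (auto simp: z0_def)
  have iso: "isolated_singularity_at g z" and ness: "not_essential g z" if "Re z \<ge> a" for z
  proof -
    have "g meromorphic_on {z}"
      using that U by (intro meromorphic_on_subset[OF g]) auto
    thus "isolated_singularity_at g z" "not_essential g z"
      by (auto simp: meromorphic_at_iff)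
  qed
  have pole0: "is_pole g z0" using poles z0U by simp
  have ord: "zorder g z0 = -1" using pole by (simp add: only_pole_simple_def z0_def)
  have r: "r = zor_poly g z0 z0"
    unfolding r_def by (rule residue_simple_pole[OF iso pole0 ord]) (simp add: z0_def)
  have "\<exists>\<^sub>F w in at z0. g w \<noteq> 0"
    using non_zero_neighbour_pole[OF pole0] by (simp add: eventually_frequently)
  from zorder_exist[OF iso ness this]
  obtain e where e: "e > 0" "zor_poly g z0 z0 \<noteq> 0" "zor_poly g z0 holomorphic_on cball z0 e"
    "\<And>w. w \<in> cball z0 e - {z0} \<Longrightarrow> g w = zor_poly g z0 w * (w - z0) powi (-1)"
    using ord by (auto simp: z0_def)
  show "residue g (of_real a) \<noteq> 0"
    using r e(2) by (simp add: r_def z0_def)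

  have lim: "\<exists>c. h \<midarrow>z\<rightarrow> c \<and> (Re z > a \<longrightarrow> c = h z)" if z: "Re z \<ge> a" "Re z < b" for z
  proof -
    consider "Re z > a" | "Re z = a" "z \<noteq> z0" | "z = z0"
      using z le_less[of a "Re z"] by (auto simp: complex_eq_iff z0_def)
    thus ?thesis
    proof cases
      case 1
      let ?S = "{s. Re s > a \<and> Re s < b}"
      have "open ?S"
        by (intro open_Collect_conj open_halfspace_Re_gt open_halfspace_Re_lt)
      moreover have "continuous_on ?S h"
        unfolding h_def by (intro continuous_intros, subst continuous_on_cong[OF refl gf])
          (use cont in \<open>auto simp: z0_def\<close>)
      ultimately have "isCont h z"
        using 1 z by (auto simp: continuous_on_eq_continuous_at)
      thus ?thesis by (auto simp: isCont_def)
    next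
      case 2
      have "\<not> is_pole g z" using poles[of z] U 2 by auto
      then obtain c where "g \<midarrow>z\<rightarrow> c"
        using ness[OF z(1)] by (auto simp: not_essential_def)
      hence "h \<midarrow>z\<rightarrow> c - r / (z - z0)"
        unfolding h_def using 2 by (intro tendsto_intros) auto
      thus ?thesis using 2 by auto
    next
      case 3
      have "(zor_poly g z0 has_field_derivative deriv (zor_poly g z0) z0) (at z0)"
        using e by (intro holomorphic_derivI[of _ "ball z0 e"]) (auto intro: holomorphic_on_subset)
      hence "((\<lambda>w. (zor_poly g z0 w - zor_poly g z0 z0) / (w - z0)) \<longlongrightarrow> deriv (zor_poly g z0) z0) (at z0)"
        by (simp add: has_field_derivative_iff)
      moreover have "eventually (\<lambda>w. w \<in> cball z0 e - {z0}) (at z0)"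
        using eventually_at_in_open[of "ball z0 e" z0] e(1) by (auto elim!: eventually_mono)
      hence "eventually (\<lambda>w. (zor_poly g z0 w - zor_poly g z0 z0) / (w - z0) = h w) (at z0)"
      proof eventually_elim
        case (elim w)
        thus ?case using e(4)[OF elim] by (simp add: h_def r divide_simps)
      qed
      ultimately have "h \<midarrow>z0\<rightarrow> deriv (zor_poly g z0) z0"
        by (rule Lim_transform_eventually)
      thus ?thesis using 3 by (auto simp: z0_def)
    qed
  qed
  have h_mero: "h meromorphic_on {s. Re s > a} \<union> U"
    unfolding h_def by (intro meromorphic_intros g)
  have ana: "remove_sings h analytic_on {z}" if "Re z \<ge> a" "Re z < b" for z
  proof -
    have "h meromorphic_on {z}"
      using that U by (intro meromorphic_on_subset[OF h_mero]) auto
    thus ?thesis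
      using lim[OF that] by (auto simp: meromorphic_at_iff intro: remove_sings_analytic_at)
  qed
  have "continuous_on {s. Re s \<ge> a \<and> Re s < b} (remove_sings h)"
    using ana by (auto intro!: continuous_at_imp_continuous_on analytic_at_imp_isCont)
  moreover have "f s = residue g (of_real a) / (s - of_real a) + remove_sings h s" if "Re s > a" "Re s < b" for s
  proof -
    have "remove_sings h s = h s"
      using lim[of s] that by (intro remove_sings_eqI) auto
    thus ?thesis using gf[of s] that by (simp add: h_def r_def z0_def)
  qed
  ultimately show "\<exists>H. continuous_on {s. Re s \<ge> a \<and> Re s < b} H \<and>
           (\<forall>s. Re s > a \<and> Re s < b \<longrightarrow> f s = residue g (of_real a) / (s - of_real a) + H s)"
    by blast
qed

section \<open>Minkowski contents and dimensions at infinity\<close>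

lemma minkowski_contents_eqI:
  assumes "((\<lambda>t. emeasure lebesgue (tail_infty t \<Omega>) / ennreal (t powr (real CARD('n) + r))) \<longlongrightarrow> m) at_top"
  shows "lower_minkowski_content_infty r (\<Omega> :: (real ^ 'n) set) = m"
    and "upper_minkowski_content_infty r \<Omega> = m"
  using assms unfolding lower_minkowski_content_infty_def upper_minkowski_content_infty_def
  by (auto intro!: lim_imp_Liminf lim_imp_Limsup)

text \<open>
  A positive finite limit of the ratio at dimension \<open>D\<close> decides all other dimensions, since the ratio at
  dimension \<open>r\<close> differs from it by the factor \<open>t powr (D - r)\<close>: the lower content vanishes for \<open>r > D\<close> and
  is bounded away from \<open>0\<close> for \<open>r \<le> D\<close>.
\<close>

lemma minkowski_measurable_from_limit:
  fixes \<Omega> :: "(real ^ 'n) set"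
  assumes \<Omega>: "\<Omega> \<in> sets lebesgue" "emeasure lebesgue \<Omega> < \<infinity>"
    and dim: "upper_minkowski_dim_infty \<Omega> = ereal D"
    and A: "A > 0"
    and lim: "((\<lambda>t. tail_volume \<Omega> t / t powr (real CARD('n) + D)) \<longlongrightarrow> A) at_top"
  shows "has_minkowski_dim_infty \<Omega> (ereal D)" "minkowski_measurable_infty \<Omega>"
    "enn2real (minkowski_content_infty D \<Omega>) = A"
proof -
  define q where "q = (\<lambda>r t. tail_volume \<Omega> t / t powr (real CARD('n) + r))"
  have ratio: "eventually (\<lambda>t. ennreal (q r t) =
      emeasure lebesgue (tail_infty t \<Omega>) / ennreal (t powr (real CARD('n) + r))) at_top" for r
    using eventually_gt_at_top[of 0]
    by eventually_elim (simp add: q_def emeasure_tail_infty[OF \<Omega>] divide_ennreal tail_volume_nonneg[OF \<Omega>])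
  have q_shift: "eventually (\<lambda>t. q D t * t powr (D - r) = q r t) at_top" for r
    using eventually_gt_at_top[of 0]
    by eventually_elim (simp add: q_def powr_add powr_diff field_simps)
  have content: "lower_minkowski_content_infty r \<Omega> = ennreal m" "upper_minkowski_content_infty r \<Omega> = ennreal m"
    if "(q r \<longlongrightarrow> m) at_top" for r m
    using minkowski_contents_eqI[OF Lim_transform_eventually[OF tendsto_ennrealI[OF that] ratio]] by auto
  have qD: "(q D \<longlongrightarrow> A) at_top" using lim by (simp add: q_def)
  note contentD = content[OF qD]
  have low0: "lower_minkowski_content_infty r \<Omega> = 0" if "r > D" for r
  proof -
    have "((\<lambda>t. q D t * t powr (D - r)) \<longlongrightarrow> A * 0) at_top"
      using that by (intro tendsto_mult qD tendsto_neg_powr filterlim_ident) auto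
    hence "(q r \<longlongrightarrow> 0) at_top"
      using Lim_transform_eventually[OF _ q_shift] by fastforce
    from content(1)[OF this] show ?thesis by simp
  qed
  have low_pos: "lower_minkowski_content_infty r \<Omega> \<noteq> 0" if "r \<le> D" for r
  proof -
    have "eventually (\<lambda>t. A / 2 < q D t) at_top"
      using A by (intro order_tendstoD(1)[OF qD]) simp
    hence "eventually (\<lambda>t. ennreal (A / 2) \<le>
        emeasure lebesgue (tail_infty t \<Omega>) / ennreal (t powr (real CARD('n) + r))) at_top"
      using ratio[of r] q_shift[of r] eventually_ge_at_top[of 1]
    proof eventually_elim
      case (elim t)
      have "A / 2 \<le> q D t" using elim by simp
      also have "\<dots> \<le> q D t * t powr (D - r)"
        using elim that A ge_one_powr_ge_zero[of t "D - r"] mult_left_mono[of 1 "t powr (D - r)" "q D t"] by simp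
      finally show ?case using elim by (metis ennreal_leI)
    qed
    hence "ennreal (A / 2) \<le> lower_minkowski_content_infty r \<Omega>"
      unfolding lower_minkowski_content_infty_def by (rule Liminf_bounded)
    thus ?thesis using A by (auto simp: ennreal_eq_0_iff)
  qed
  have "lower_minkowski_dim_infty \<Omega> = ereal D"
  proof (rule antisym)
    show "lower_minkowski_dim_infty \<Omega> \<le> ereal D"
    proof (rule ereal_le_epsilon2)
      fix e :: real assume "e > 0"
      hence "lower_minkowski_dim_infty \<Omega> \<le> ereal (D + e)"
        unfolding lower_minkowski_dim_infty_def by (intro INF_lower) (auto intro: low0)
      thus "lower_minkowski_dim_infty \<Omega> \<le> ereal D + ereal e" by simp
    qed
    show "ereal D \<le> lower_minkowski_dim_infty \<Omega>"
      unfolding lower_minkowski_dim_infty_def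
      using low_pos by (intro INF_greatest) (metis (lifting) ereal_less_eq(3) linorder_le_cases mem_Collect_eq)
  qed
  thus has_dim: "has_minkowski_dim_infty \<Omega> (ereal D)"
    using dim by (simp add: has_minkowski_dim_infty_def)
  show "minkowski_measurable_infty \<Omega>"
    unfolding minkowski_measurable_infty_def
    using has_dim A by (intro exI[of _ D]) (auto simp: contentD)
  have "minkowski_content_infty D \<Omega> = ennreal A"
    unfolding minkowski_content_infty_def by (simp add: contentD)
  thus "enn2real (minkowski_content_infty D \<Omega>) = A" using A by simp
qed

text \<open>
  The Tauberian theorem needs a real coefficient. The tube zeta function is real on the real axis, so
  \<open>Im A\<close> is the limit of \<open>- \<epsilon> * Im (H (D + \<epsilon>))\<close> at \<open>\<epsilon> \<rightarrow> 0\<close>, which is \<open>0\<close>. Being the limit of a nonnegative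
  function, \<open>A\<close> is then positive as soon as it is nonzero.
\<close>

lemma measurable_of_tube_zeta_decomposition:
  fixes \<Omega> :: "(real ^ 'n) set"
  assumes \<Omega>: "\<Omega> \<in> sets lebesgue" "emeasure lebesgue \<Omega> < \<infinity>"
    and dim: "upper_minkowski_dim_infty \<Omega> = ereal D" and DN: "D < - real CARD('n)"
    and T: "T > 0" and b: "D < b" and A: "A \<noteq> 0"
    and H: "continuous_on {s. Re s \<ge> D \<and> Re s < b} H"
    and decomp: "\<And>s. Re s > D \<Longrightarrow> Re s < b \<Longrightarrow> tube_zeta_infty T \<Omega> s = A / (s - of_real D) + H s"
  shows "has_minkowski_dim_infty \<Omega> (ereal D)" "minkowski_measurable_infty \<Omega>"
    "complex_of_real (enn2real (minkowski_content_infty D \<Omega>)) = A"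
proof -
  define B where "B = log_tail \<Omega> D T"
  define G where "G = (\<lambda>w. H (of_real D + w))"
  have G: "continuous_on {s. 0 \<le> Re s \<and> Re s < b - D} G"
    unfolding G_def by (rule continuous_on_compose2[OF H]) (auto intro!: continuous_intros)
  have laplace: "(\<integral>x. B x *\<^sub>R exp (-(w * of_real x)) \<partial>lborel) = A / w + G w"
    if "0 < Re w" "Re w < b - D" for w :: complex
    using tube_zeta_eq_laplace[OF \<Omega> T, of "of_real D + w" D] decomp[of "of_real D + w"] that
    by (simp add: B_def G_def)
  have "Im A = 0"
  proof -
    have real: "(\<integral>x. B x *\<^sub>R exp (-(complex_of_real \<epsilon> * of_real x)) \<partial>lborel) \<in> \<real>" for \<epsilon> :: real
    proof -
      have "(\<integral>x. B x *\<^sub>R exp (-(of_real \<epsilon> * of_real x)) \<partial>lborel) = (\<integral>x. complex_of_real (B x * exp (-(\<epsilon> * x))) \<partial>lborel)"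
        by (intro Bochner_Integration.integral_cong) (auto simp: scaleR_conv_of_real exp_of_real [symmetric])
      thus ?thesis by (simp only: integral_complex_of_real Reals_of_real)
    qed
    have im: "Im A + \<epsilon> * Im (G (of_real \<epsilon>)) = 0" if "0 < \<epsilon>" "\<epsilon> < b - D" for \<epsilon>
    proof -
      have "A + \<epsilon> * G (of_real \<epsilon>) = of_real \<epsilon> * (\<integral>x. B x *\<^sub>R exp (-(of_real \<epsilon> * of_real x)) \<partial>lborel)"
        using laplace[of "of_real \<epsilon>"] that by (simp add: field_simps)
      also have "\<dots> \<in> \<real>" using real[of \<epsilon>] by simp
      finally show ?thesis by (simp add: complex_is_Real_iff)
    qed
    have "((\<lambda>\<epsilon>. G (of_real \<epsilon>)) \<longlongrightarrow> G (of_real 0)) (at_right 0)"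
    proof (rule continuous_on_tendsto_compose[OF G])
      show "\<forall>\<^sub>F \<epsilon> in at_right 0. complex_of_real \<epsilon> \<in> {s. 0 \<le> Re s \<and> Re s < b - D}"
        using eventually_at_right_real[of 0 "b - D"] b by (auto elim!: eventually_mono)
      show "((\<lambda>\<epsilon>. complex_of_real \<epsilon>) \<longlongrightarrow> of_real 0) (at_right 0)"
        by (intro tendsto_of_real tendsto_ident_at)
    qed (use b in auto)
    hence "((\<lambda>\<epsilon>. Im A + \<epsilon> * Im (G (of_real \<epsilon>))) \<longlongrightarrow> Im A + 0 * Im (G (of_real 0))) (at_right 0)"
      by (intro tendsto_intros)
    moreover have "eventually (\<lambda>\<epsilon>. Im A + \<epsilon> * Im (G (of_real \<epsilon>)) = 0) (at_right 0)"
      using eventually_at_right_real[of 0 "b - D"] b im by (auto elim!: eventually_mono)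
    hence "((\<lambda>\<epsilon>. Im A + \<epsilon> * Im (G (of_real \<epsilon>))) \<longlongrightarrow> 0) (at_right 0)"
      by (rule tendsto_eventually)
    ultimately have "Im A + 0 * Im (G (of_real 0)) = 0"
      by (intro tendsto_unique[OF trivial_limit_at_right_real])
    thus ?thesis by simp
  qed
  hence A_eq: "A = of_real (Re A)" by (simp add: complex_eq_iff)
  have B_lim: "(B \<longlongrightarrow> Re A) at_top"
  proof (rule wiener_ikehara[where c = "ln T" and \<delta> = "-(D + real CARD('n))" and \<eta> = "b - D" and H = G])
    show "B \<in> borel_measurable borel" "\<And>x. B x \<ge> 0"
      unfolding B_def using borel_measurable_log_tail[OF \<Omega>] log_tail_nonneg[OF \<Omega>] by auto
    show "B x = 0" if "x < ln T" for x using that by (simp add: B_def log_tail_def)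
    show "B y \<le> exp (-(D + real CARD('n)) * (y - x)) * B x" if "ln T \<le> x" "x \<le> y" for x y
      unfolding B_def by (rule log_tail_growth[OF \<Omega> that])
    show "integrable lborel (\<lambda>x. B x * exp (-(\<epsilon> * x)))" if "\<epsilon> > 0" for \<epsilon>
      unfolding B_def by (rule integrable_log_tail[OF \<Omega> dim that])
    show "(\<integral>x. B x *\<^sub>R exp (-(w * of_real x)) \<partial>lborel) = of_real (Re A) / w + G w"
      if "0 < Re w" "Re w < b - D" for w :: complex
      using laplace[OF that] A_eq by simp
  qed (use DN b G in auto)
  have "Re A \<ge> 0"
    by (rule tendsto_lowerbound[OF B_lim]) (auto simp: B_def log_tail_nonneg[OF \<Omega>])
  hence Re_pos: "Re A > 0" using A A_eq by (metis less_eq_real_def of_real_0)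
  have "((\<lambda>t. B (ln t)) \<longlongrightarrow> Re A) at_top"
    by (rule filterlim_compose[OF B_lim ln_at_top])
  moreover have "eventually (\<lambda>t. B (ln t) = tail_volume \<Omega> t / t powr (real CARD('n) + D)) at_top"
    using eventually_ge_at_top[of T]
  proof eventually_elim
    case (elim t)
    have t: "t > 0" "ln T \<le> ln t" using elim T by auto
    hence "t powr (real CARD('n) + D) = exp ((D + real CARD('n)) * ln t)"
      by (simp add: powr_def add.commute)
    thus ?case
      using t by (simp add: B_def log_tail_def exp_minus divide_inverse mult.commute)
  qed
  ultimately have lim: "((\<lambda>t. tail_volume \<Omega> t / t powr (real CARD('n) + D)) \<longlongrightarrow> Re A) at_top"
    by (rule Lim_transform_eventually)
  note concl = minkowski_measurable_from_limit[OF \<Omega> dim Re_pos lim]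
  show "has_minkowski_dim_infty \<Omega> (ereal D)" "minkowski_measurable_infty \<Omega>"
    by (fact concl(1,2))+
  show "complex_of_real (enn2real (minkowski_content_infty D \<Omega>)) = A"
    using concl(3) A_eq by simp
qed

theorem theorem3p6:
  fixes \<Omega> :: "(real ^ 'n) set" and Dbar T :: real
  assumes "\<Omega> \<in> sets lebesgue"
    and "emeasure lebesgue \<Omega> < \<infinity>"
    and "upper_minkowski_dim_infty \<Omega> = ereal Dbar"
    and "Dbar < - real CARD('n)"
    and "T > 0"
  shows "(\<forall>U g. meromorphic_extension (tube_zeta_infty T \<Omega>) Dbar U g \<longrightarrow>
            only_pole_simple g U (complex_of_real Dbar) \<longrightarrow>
            has_minkowski_dim_infty \<Omega> (ereal Dbar) \<and>
            minkowski_measurable_infty \<Omega> \<and>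
            complex_of_real (enn2real (minkowski_content_infty Dbar \<Omega>))
              = residue g (complex_of_real Dbar)) \<and>
         (\<forall>U g. meromorphic_extension (distance_zeta_infty T \<Omega>) Dbar U g \<longrightarrow>
            only_pole_simple g U (complex_of_real Dbar) \<longrightarrow>
            has_minkowski_dim_infty \<Omega> (ereal Dbar) \<and>
            minkowski_measurable_infty \<Omega> \<and>
            complex_of_real (enn2real (minkowski_content_infty Dbar \<Omega>))
              = residue g (complex_of_real Dbar) / complex_of_real (- (real CARD('n) + Dbar)))"
proof (intro conjI[of "\<forall>U g. _ U g"] allI impI)
  fix U g
  assume ext: "meromorphic_extension (tube_zeta_infty T \<Omega>) Dbar U g"
    and pole: "only_pole_simple g U (complex_of_real Dbar)"
  \<comment> \<open>Any right edge beyond \<open>Dbar\<close> would do; \<open>- N\<close> is the one that the second part requires.\<close>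
  have cont: "continuous_on {s. Re s > Dbar \<and> Re s < - real CARD('n)} (tube_zeta_infty T \<Omega>)"
    using continuous_on_tube_zeta[OF assms(1,2,3,5)] by (rule continuous_on_subset) auto
  note reg = simple_pole_regular_part[OF ext pole cont]
  obtain H where "continuous_on {s. Re s \<ge> Dbar \<and> Re s < - real CARD('n)} H"
    "\<And>s. Re s > Dbar \<Longrightarrow> Re s < - real CARD('n) \<Longrightarrow>
       tube_zeta_infty T \<Omega> s = residue g (of_real Dbar) / (s - of_real Dbar) + H s"
    using reg(2) by auto
  from measurable_of_tube_zeta_decomposition[OF assms(1,2,3,4,5,4) reg(1) this]
  show "has_minkowski_dim_infty \<Omega> (ereal Dbar) \<and> minkowski_measurable_infty \<Omega> \<and>
      complex_of_real (enn2real (minkowski_content_infty Dbar \<Omega>)) = residue g (complex_of_real Dbar)"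
    by blast
next
  fix U g
  assume ext: "meromorphic_extension (distance_zeta_infty T \<Omega>) Dbar U g"
    and pole: "only_pole_simple g U (complex_of_real Dbar)"
  let ?n = "real CARD('n)"
  let ?S = "{s. Re s > Dbar \<and> Re s < - ?n}"
  define p where "p = (\<lambda>s. - s - complex_of_nat CARD('n))"
  define c where "c = (\<lambda>s. of_real T powr p s * complex_of_real (tail_volume \<Omega> T))"
  define R where "R = residue g (complex_of_real Dbar)"
  define p0 where "p0 = complex_of_real (- (?n + Dbar))"
  have dist: "distance_zeta_infty T \<Omega> s = c s + p s * tube_zeta_infty T \<Omega> s" if "s \<in> ?S" for s
    using distance_zeta_eq_tube_zeta[OF assms(1,2,3,5), of s] that by (simp add: c_def p_def)
  have p_nz: "p s \<noteq> 0" if "Re s < - ?n" for s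
    using that by (auto simp: p_def complex_eq_iff)
  have c_cont: "continuous_on X c" and p_cont: "continuous_on X p" for X
    unfolding c_def p_def using assms(5) by (auto intro!: continuous_intros)
  have "continuous_on ?S (tube_zeta_infty T \<Omega>)"
    using continuous_on_tube_zeta[OF assms(1,2,3,5)] by (rule continuous_on_subset) auto
  hence "continuous_on ?S (\<lambda>s. c s + p s * tube_zeta_infty T \<Omega> s)"
    by (intro continuous_intros c_cont p_cont)
  hence cont: "continuous_on ?S (distance_zeta_infty T \<Omega>)"
    by (subst continuous_on_cong[OF refl dist])
  note reg = simple_pole_regular_part[OF ext pole cont, folded R_def]
  obtain H where H: "continuous_on {s. Re s \<ge> Dbar \<and> Re s < - ?n} H"
    "\<And>s. s \<in> ?S \<Longrightarrow> distance_zeta_infty T \<Omega> s = R / (s - of_real Dbar) + H s"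
    using reg(2) by auto
  have p0: "p0 \<noteq> 0" using assms(4) by (auto simp: p0_def complex_eq_iff)
  \<comment> \<open>Dividing by \<open>p s = p0 - (s - Dbar)\<close> keeps the pole simple and divides the residue by \<open>p0\<close>; this is
    the continuous remainder, obtained from \<open>1 / ((s - Dbar) * p s) = 1 / (p0 * (s - Dbar)) + 1 / (p0 * p s)\<close>.\<close>
  define G where "G = (\<lambda>s. R / (p0 * p s) + (H s - c s) / p s)"
  have G_cont: "continuous_on {s. Re s \<ge> Dbar \<and> Re s < - ?n} G"
    unfolding G_def using p0 p_nz by (intro continuous_intros H c_cont p_cont) auto
  have "tube_zeta_infty T \<Omega> s = (R / p0) / (s - of_real Dbar) + G s"
    if s: "Re s > Dbar" "Re s < - ?n" for s
  proof -
    have nz: "p s \<noteq> 0" "s - of_real Dbar \<noteq> 0" using s p_nz by auto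
    have ps: "p s = p0 - (s - of_real Dbar)" by (simp add: p_def p0_def)
    have "tube_zeta_infty T \<Omega> s = (R / (s - of_real Dbar) + H s - c s) / p s"
      using dist[of s] H(2)[of s] s nz by (simp add: field_simps)
    also have "\<dots> = R / ((s - of_real Dbar) * p s) + (H s - c s) / p s"
      by (simp add: add_divide_distrib diff_divide_distrib)
    also have "R / ((s - of_real Dbar) * p s) = (R / p0) / (s - of_real Dbar) + R / (p0 * p s)"
    proof -
      have "(R / p0) / (s - of_real Dbar) + R / (p0 * p s) = R * (p s + (s - of_real Dbar)) / (p0 * (s - of_real Dbar) * p s)"
        using nz p0 by (simp add: divide_simps) (simp add: algebra_simps)
      also have "p s + (s - of_real Dbar) = p0" by (simp add: ps)
      finally show ?thesis using p0 by simp
    qed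
    finally show ?thesis by (simp add: G_def)
  qed
  from measurable_of_tube_zeta_decomposition[OF assms(1,2,3,4,5,4) _ G_cont this] reg(1) p0
  show "has_minkowski_dim_infty \<Omega> (ereal Dbar) \<and> minkowski_measurable_infty \<Omega> \<and>
      complex_of_real (enn2real (minkowski_content_infty Dbar \<Omega>))
        = residue g (complex_of_real Dbar) / complex_of_real (- (real CARD('n) + Dbar))"
    by (simp add: R_def p0_def)
qed

end
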